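(* Let $R$ be an associative ring with identity which is right $GC2$ and such that every cyclic right $R$-module can be embedded in a free right $R$-module (i.e. $R$ is a right $CF$-ring). If $R$ is right weak $CS$, then $R$ is right artinian. Likewise, if $R$ is right $s$-$CS$, then $R$ is right artinian.
   Context: Rings are associative with identity and modules are unitary. A right $R$-module $M$ is weak $CS$ if every semisimple submodule of $M$ is essential in a direct summand of $M$. A right $R$-module $M$ is $s$-$CS$ if every singular submodule of $M$ is essential in a direct summand of $M$ (a module is singular if the annihilator of each of its elements is an essential right ideal of $R$). A right $R$-module $M$ is $GC2$ if every submodule of $M$ isomorphic to $M$ is a direct summand of $M$. The ring $R$ is right weak $CS$ (respectively right $s$-$CS$, right $GC2$) if the right module $R_R$ is weak $CS$ (respectively $s$-$CS$, $GC2$). *)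

theory Defs
  imports "HOL-Algebra.Algebra"
begin

text \<open>
  The locale \<open>module\<close> of HOL-Algebra requires a commutative ring. Here right modules over an
  arbitrary ring are put on the same record type. Pitfall: the record operation has the scalar
  as its first argument, so \<open>r \<odot>\<^bsub>M\<^esub> x\<close> stands for the right action \<open>x \<cdot> r\<close>; this is why the
  product is reversed in \<open>smult_assoc\<close>. The locale \<open>submodule\<close> of HOL-Algebra only states
  closure properties, does not assume commutativity, and is used unchanged.
\<close>

locale right_module = R?: ring R + M?: abelian_group M
  for R :: "('a, 'm) ring_scheme" (structure) and M :: "('a, 'b, 'n) module_scheme" (structure) +
  assumes smult_closed:
      "\<lbrakk>r \<in> carrier R; x \<in> carrier M\<rbrakk> \<Longrightarrow> r \<odot>\<^bsub>M\<^esub> x \<in> carrier M"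
    and smult_scalar_distr:
      "\<lbrakk>r \<in> carrier R; s \<in> carrier R; x \<in> carrier M\<rbrakk> \<Longrightarrow>
        (r \<oplus>\<^bsub>R\<^esub> s) \<odot>\<^bsub>M\<^esub> x = r \<odot>\<^bsub>M\<^esub> x \<oplus>\<^bsub>M\<^esub> s \<odot>\<^bsub>M\<^esub> x"
    and smult_vector_distr:
      "\<lbrakk>r \<in> carrier R; x \<in> carrier M; y \<in> carrier M\<rbrakk> \<Longrightarrow>
        r \<odot>\<^bsub>M\<^esub> (x \<oplus>\<^bsub>M\<^esub> y) = r \<odot>\<^bsub>M\<^esub> x \<oplus>\<^bsub>M\<^esub> r \<odot>\<^bsub>M\<^esub> y"
    and smult_assoc:
      "\<lbrakk>r \<in> carrier R; s \<in> carrier R; x \<in> carrier M\<rbrakk> \<Longrightarrow>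
        (r \<otimes>\<^bsub>R\<^esub> s) \<odot>\<^bsub>M\<^esub> x = s \<odot>\<^bsub>M\<^esub> (r \<odot>\<^bsub>M\<^esub> x)"
    and smult_unit:
      "x \<in> carrier M \<Longrightarrow> \<one>\<^bsub>R\<^esub> \<odot>\<^bsub>M\<^esub> x = x"

text \<open>The right module \<open>R\<^sub>R\<close>; its submodules are the right ideals of \<open>R\<close>.\<close>

definition regular_right_module :: "('a, 'm) ring_scheme \<Rightarrow> ('a, 'a) module" where
  "regular_right_module R =
     \<lparr>carrier = carrier R, monoid.mult = monoid.mult R, one = one R, 
      ring.zero = ring.zero R, ring.add = ring.add R,
      smult = (\<lambda>r x. x \<otimes>\<^bsub>R\<^esub> r)\<rparr>"

definition right_module_hom ::
    "('a, 'm) ring_scheme \<Rightarrow> ('a, 'b, 'n) module_scheme \<Rightarrow> ('a, 'c, 'k) module_scheme \<Rightarrow> ('b \<Rightarrow> 'c) set"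
  where
  "right_module_hom R M N =
     {h \<in> carrier M \<rightarrow> carrier N.
        (\<forall>x\<in>carrier M. \<forall>y\<in>carrier M. h (x \<oplus>\<^bsub>M\<^esub> y) = h x \<oplus>\<^bsub>N\<^esub> h y) \<and>
        (\<forall>r\<in>carrier R. \<forall>x\<in>carrier M. h (r \<odot>\<^bsub>M\<^esub> x) = r \<odot>\<^bsub>N\<^esub> h x)}"

definition right_module_embeds ::
    "('a, 'm) ring_scheme \<Rightarrow> ('a, 'b, 'n) module_scheme \<Rightarrow> ('a, 'c, 'k) module_scheme \<Rightarrow> bool"
  where
  "right_module_embeds R M N \<longleftrightarrow> (\<exists>h\<in>right_module_hom R M N. inj_on h (carrier M))"

definition right_module_iso ::
    "('a, 'm) ring_scheme \<Rightarrow> ('a, 'b, 'n) module_scheme \<Rightarrow> ('a, 'c, 'k) module_scheme \<Rightarrow> bool"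
  where
  "right_module_iso R M N \<longleftrightarrow> (\<exists>h\<in>right_module_hom R M N. bij_betw h (carrier M) (carrier N))"

definition cyclic_right_module :: "('a, 'm) ring_scheme \<Rightarrow> ('a, 'b, 'n) module_scheme \<Rightarrow> bool" where
  "cyclic_right_module R M \<longleftrightarrow>
     right_module R M \<and> (\<exists>x\<in>carrier M. carrier M = {r \<odot>\<^bsub>M\<^esub> x | r. r \<in> carrier R})"

text \<open>A basis: every element has a unique family of coefficients of finite support. The basis may
  be infinite.\<close>

definition right_module_basis ::
    "('a, 'm) ring_scheme \<Rightarrow> ('a, 'b, 'n) module_scheme \<Rightarrow> 'b set \<Rightarrow> bool" where
  "right_module_basis R M B \<longleftrightarrow>
     B \<subseteq> carrier M \<and>
     (\<forall>x\<in>carrier M. \<exists>!f. f \<in> B \<rightarrow>\<^sub>E carrier R \<and> finite {b \<in> B. f b \<noteq> \<zero>\<^bsub>R\<^esub>} \<and>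
        x = finsum M (\<lambda>b. f b \<odot>\<^bsub>M\<^esub> b) {b \<in> B. f b \<noteq> \<zero>\<^bsub>R\<^esub>})"

definition free_right_module :: "('a, 'm) ring_scheme \<Rightarrow> ('a, 'b, 'n) module_scheme \<Rightarrow> bool" where
  "free_right_module R M \<longleftrightarrow> right_module R M \<and> (\<exists>B. right_module_basis R M B)"

text \<open>
  Every cyclic right module embeds in a free right module. HOL cannot quantify over types inside
  a formula, so the carrier types are explicit.

  \<^item> Cyclic modules have carriers in the type \<open>'a set\<close>. It contains all quotients of \<open>R\<^sub>R\<close>,
    so every cyclic module over \<open>R\<close> is covered up to isomorphism; see \<open>right_CF_ring_embeds\<close> below.
  \<^item> The free modules have carriers in the type \<open>'f\<close>, which is a parameter. As a hypothesis of a
    theorem with \<open>'f\<close> a type variable, the free modules may thus have any size whatsoever. (A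
    cyclic module that embeds in a free module embeds in one of finite rank, so the type
    \<open>nat \<Rightarrow> 'a\<close> already suffices.)
\<close>

definition right_CF_ring :: "('a, 'm) ring_scheme \<Rightarrow> 'f itself \<Rightarrow> bool" where
  "right_CF_ring R (_ :: 'f itself) \<longleftrightarrow>
     (\<forall>C :: ('a, 'a set) module. cyclic_right_module R C \<longrightarrow>
        (\<exists>F :: ('a, 'f) module. free_right_module R F \<and> right_module_embeds R C F))"

definition direct_summand ::
    "('a, 'm) ring_scheme \<Rightarrow> ('a, 'b, 'n) module_scheme \<Rightarrow> 'b set \<Rightarrow> bool" where
  "direct_summand R M D \<longleftrightarrow>
     submodule D R M \<and>
     (\<exists>D'. submodule D' R M \<and> D \<inter> D' = {\<zero>\<^bsub>M\<^esub>} \<and> D <+>\<^bsub>M\<^esub> D' = carrier M)"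

definition essential_in ::
    "('a, 'm) ring_scheme \<Rightarrow> ('a, 'b, 'n) module_scheme \<Rightarrow> 'b set \<Rightarrow> 'b set \<Rightarrow> bool" where
  "essential_in R M N K \<longleftrightarrow>
     submodule N R M \<and> submodule K R M \<and> N \<subseteq> K \<and>
     (\<forall>L. submodule L R M \<and> L \<subseteq> K \<and> L \<noteq> {\<zero>\<^bsub>M\<^esub>} \<longrightarrow> N \<inter> L \<noteq> {\<zero>\<^bsub>M\<^esub>})"

definition simple_submodule ::
    "('a, 'm) ring_scheme \<Rightarrow> ('a, 'b, 'n) module_scheme \<Rightarrow> 'b set \<Rightarrow> bool" where
  "simple_submodule R M S \<longleftrightarrow>
     submodule S R M \<and> S \<noteq> {\<zero>\<^bsub>M\<^esub>} \<and>
     (\<forall>L. submodule L R M \<and> L \<subseteq> S \<longrightarrow> L = {\<zero>\<^bsub>M\<^esub>} \<or> L = S)"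

text \<open>A semisimple submodule is the sum of its simple submodules; the sum of a family is the least
  submodule containing all its members.\<close>

definition semisimple_submodule ::
    "('a, 'm) ring_scheme \<Rightarrow> ('a, 'b, 'n) module_scheme \<Rightarrow> 'b set \<Rightarrow> bool" where
  "semisimple_submodule R M N \<longleftrightarrow>
     submodule N R M \<and>
     N = \<Inter>{L. submodule L R M \<and> (\<forall>S. simple_submodule R M S \<and> S \<subseteq> N \<longrightarrow> S \<subseteq> L)}"

definition right_annihilator ::
    "('a, 'm) ring_scheme \<Rightarrow> ('a, 'b, 'n) module_scheme \<Rightarrow> 'b \<Rightarrow> 'a set" where
  "right_annihilator R M x = {r \<in> carrier R. r \<odot>\<^bsub>M\<^esub> x = \<zero>\<^bsub>M\<^esub>}"

definition singular_submodule ::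
    "('a, 'm) ring_scheme \<Rightarrow> ('a, 'b, 'n) module_scheme \<Rightarrow> 'b set \<Rightarrow> bool" where
  "singular_submodule R M N \<longleftrightarrow>
     submodule N R M \<and>
     (\<forall>x\<in>N. essential_in R (regular_right_module R) (right_annihilator R M x) (carrier R))"

definition weak_CS_module :: "('a, 'm) ring_scheme \<Rightarrow> ('a, 'b, 'n) module_scheme \<Rightarrow> bool" where
  "weak_CS_module R M \<longleftrightarrow>
     (\<forall>N. semisimple_submodule R M N \<longrightarrow> (\<exists>D. direct_summand R M D \<and> essential_in R M N D))"

definition s_CS_module :: "('a, 'm) ring_scheme \<Rightarrow> ('a, 'b, 'n) module_scheme \<Rightarrow> bool" where
  "s_CS_module R M \<longleftrightarrow>
     (\<forall>N. singular_submodule R M N \<longrightarrow> (\<exists>D. direct_summand R M D \<and> essential_in R M N D))"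

definition GC2_module :: "('a, 'm) ring_scheme \<Rightarrow> ('a, 'b, 'n) module_scheme \<Rightarrow> bool" where
  "GC2_module R M \<longleftrightarrow>
     (\<forall>N. submodule N R M \<and> right_module_iso R M (M\<lparr>carrier := N\<rparr>) \<longrightarrow> direct_summand R M N)"

definition artinian_module :: "('a, 'm) ring_scheme \<Rightarrow> ('a, 'b, 'n) module_scheme \<Rightarrow> bool" where
  "artinian_module R M \<longleftrightarrow>
     (\<forall>I :: nat \<Rightarrow> 'b set. (\<forall>n. submodule (I n) R M) \<and> (\<forall>n. I (Suc n) \<subseteq> I n) \<longrightarrow>
        (\<exists>n. \<forall>m\<ge>n. I m = I n))"

definition right_weak_CS_ring :: "('a, 'm) ring_scheme \<Rightarrow> bool" where
  "right_weak_CS_ring R \<longleftrightarrow> weak_CS_module R (regular_right_module R)"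

definition right_s_CS_ring :: "('a, 'm) ring_scheme \<Rightarrow> bool" where
  "right_s_CS_ring R \<longleftrightarrow> s_CS_module R (regular_right_module R)"

definition right_GC2_ring :: "('a, 'm) ring_scheme \<Rightarrow> bool" where
  "right_GC2_ring R \<longleftrightarrow> GC2_module R (regular_right_module R)"

definition right_artinian_ring :: "('a, 'm) ring_scheme \<Rightarrow> bool" where
  "right_artinian_ring R \<longleftrightarrow> artinian_module R (regular_right_module R)"

lemma (in ring) regular_right_module: "right_module R (regular_right_module R)"
proof -
  have "abelian_group (regular_right_module R)"
    by (rule abelian_groupI)
       (auto simp: regular_right_module_def a_ac intro: l_neg bexI[of _ "\<ominus> _"])
  then show ?thesis
    by (intro right_module.intro right_module_axioms.intro ring_axioms)
       (auto simp: regular_right_module_def l_distr r_distr m_assoc)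
qed

lemma right_module_embeds_trans:
  assumes "right_module_embeds R L M" "right_module_embeds R M N"
  shows "right_module_embeds R L N"
proof -
  obtain g h where gh: "g \<in> right_module_hom R L M" "inj_on g (carrier L)"
      "h \<in> right_module_hom R M N" "inj_on h (carrier M)"
    using assms unfolding right_module_embeds_def by blast
  then have "h \<circ> g \<in> right_module_hom R L N"
    by (auto simp: right_module_hom_def Pi_iff)
  moreover have "inj_on (h \<circ> g) (carrier L)"
    using gh by (auto simp: right_module_hom_def Pi_iff inj_on_def)
  ultimately show ?thesis
    unfolding right_module_embeds_def by blast
qed

text \<open>Restricting the carriers of cyclic modules to \<open>'a set\<close> loses nothing: an element \<open>c\<close> of a
  cyclic module generated by \<open>x\<close> is represented by the set of all \<open>r\<close> with \<open>c = x \<cdot> r\<close>.\<close>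

lemma right_CF_ring_embeds:
  fixes R :: "('a, 'm) ring_scheme" and C :: "('a, 'c, 'n) module_scheme"
  assumes CF: "right_CF_ring R TYPE('f)" and cyc: "cyclic_right_module R C"
  shows "\<exists>F :: ('a, 'f) module. free_right_module R F \<and> right_module_embeds R C F"
proof -
  interpret C: right_module R C
    using cyc by (simp add: cyclic_right_module_def)
  obtain x where x: "x \<in> carrier C" and gen: "carrier C = {r \<odot>\<^bsub>C\<^esub> x | r. r \<in> carrier R}"
    using cyc by (auto simp: cyclic_right_module_def)
  define q where "q c = {r \<in> carrier R. r \<odot>\<^bsub>C\<^esub> x = c}" for c
  define p where "p = inv_into (carrier C) q"
  have inj: "inj_on q (carrier C)"
    unfolding inj_on_def q_def using gen by auto
  have pq [simp]: "p (q c) = c" if "c \<in> carrier C" for c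
    using that inj by (simp add: p_def)
  define D :: "('a, 'a set) module" where
    "D = \<lparr>carrier = q ` carrier C, monoid.mult = undefined, one = undefined, ring.zero = q \<zero>\<^bsub>C\<^esub>,
      ring.add = (\<lambda>a b. q (p a \<oplus>\<^bsub>C\<^esub> p b)), smult = (\<lambda>r a. q (r \<odot>\<^bsub>C\<^esub> p a))\<rparr>"
  have "abelian_group D"
    by (rule abelian_groupI)
       (auto simp: D_def C.M.a_ac C.M.l_neg C.M.r_neg intro!: bexI[of _ "\<ominus>\<^bsub>C\<^esub> _"])
  then have "right_module R D"
    by (intro right_module.intro right_module_axioms.intro C.R.ring_axioms)
       (auto simp: D_def C.smult_closed C.smult_scalar_distr C.smult_vector_distr C.smult_assoc
         C.smult_unit)
  moreover have "carrier D = {r \<odot>\<^bsub>D\<^esub> q x | r. r \<in> carrier R}"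
    using x gen by (auto simp: D_def)
  moreover have "q x \<in> carrier D"
    using x by (simp add: D_def)
  ultimately have "cyclic_right_module R D"
    unfolding cyclic_right_module_def by blast
  then obtain F :: "('a, 'f) module"
    where F: "free_right_module R F" "right_module_embeds R D F"
    using CF unfolding right_CF_ring_def by blast
  have "q \<in> right_module_hom R C D"
    by (auto simp: right_module_hom_def D_def)
  then have "right_module_embeds R C D"
    using inj unfolding right_module_embeds_def by blast
  then show ?thesis
    using F right_module_embeds_trans by blast
qed

end

theory Submission
  imports Defs
begin

text \<open>
  Both hypotheses make every singular semisimple right ideal essential in a direct summand. Since
  \<open>R\<close> is right \<open>GC2\<close>, every singular element lies in the Jacobson radical: \<open>1 - z\<close> is injective, hence
  left invertible. By the \<open>CF\<close> condition every right ideal is the right annihilator of a finite set,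
  so every simple module embeds in \<open>R\<close>.

  Let \<open>\<Lambda>\<close> represent the isomorphism classes of singular simple right ideals. For \<open>A \<subseteq> \<Lambda>\<close> choose an
  idempotent \<open>e\<^sub>A\<close> such that the sum of \<open>A\<close> is essential in \<open>e\<^sub>A R\<close>. For disjoint \<open>A\<close> and \<open>B\<close> the set
  \<open>e\<^sub>A R e\<^sub>B\<close> is singular, so no simple module is a quotient of both \<open>e\<^sub>A R\<close> and \<open>e\<^sub>B R\<close>. If \<open>\<Lambda>\<close> were
  infinite, a diagonal argument along an independent family of \<open>|\<Lambda>|\<close> subsets of \<open>\<Lambda>\<close> would yield a simple
  quotient of \<open>e\<^sub>\<Lambda> R\<close> outside \<open>\<Lambda>\<close>. Hence \<open>\<Lambda>\<close> is finite, and choosing a simple quotient of each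
  \<open>e\<^sub>j R\<close> (\<open>j \<in> \<Lambda>\<close>) permutes \<open>\<Lambda>\<close>. It follows that the trace ideal of the modules \<open>vR\<close> with simple essential
  socle is contained in no maximal right ideal, so \<open>R\<close> embeds in a finite sum of such modules. By
  \<open>CF\<close> again the same holds for every \<open>R/I\<close>, which gives the descending chain condition.
\<close>

section \<open>Right ideals and singular elements\<close>

context ring
begin

definition right_ideal :: "'a set \<Rightarrow> bool" where
  "right_ideal I \<longleftrightarrow> I \<subseteq> carrier R \<and> \<zero> \<in> I \<and> (\<forall>x\<in>I. \<forall>y\<in>I. x \<oplus> y \<in> I) \<and>
     (\<forall>x\<in>I. \<forall>r\<in>carrier R. x \<otimes> r \<in> I)"

definition rann :: "'a set \<Rightarrow> 'a set" where
  "rann F = {r \<in> carrier R. \<forall>x\<in>F. x \<otimes> r = \<zero>}"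

text \<open>Essentiality tested on cyclic submodules. For right ideals with \<open>N\<close> inside
  \<open>K\<close> it agrees with \<open>essential_in\<close>.\<close>

definition ess_in :: "'a set \<Rightarrow> 'a set \<Rightarrow> bool" where
  "ess_in N K \<longleftrightarrow> (\<forall>a\<in>K. a \<noteq> \<zero> \<longrightarrow> (\<exists>r\<in>carrier R. a \<otimes> r \<in> N \<and> a \<otimes> r \<noteq> \<zero>))"

definition right_singular :: "'a set" where
  "right_singular = {z \<in> carrier R. ess_in (rann {z}) (carrier R)}"

text \<open>\<open>simple_gen x\<close> says that \<open>xR\<close> is simple, and on such elements \<open>simple_equiv x y\<close> says that
  \<open>xR\<close> and \<open>yR\<close> are isomorphic.\<close>

definition simple_gen :: "'a \<Rightarrow> bool" where
  "simple_gen x \<longleftrightarrow> x \<in> carrier R \<and> x \<noteq> \<zero> \<and>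
     (\<forall>w\<in>carrier R. x \<otimes> w \<noteq> \<zero> \<longrightarrow> (\<exists>t\<in>carrier R. x \<otimes> w \<otimes> t = x))"

definition simple_equiv :: "'a \<Rightarrow> 'a \<Rightarrow> bool" where
  "simple_equiv x y \<longleftrightarrow> (\<exists>a\<in>carrier R. rann {y \<otimes> a} = rann {x})"

text \<open>Elements arise by adding one multiple of a generator at a time, so that induction peels
  off the last summand.\<close>

inductive_set right_span :: "'a set \<Rightarrow> 'a set" for A where
  zero: "\<zero> \<in> right_span A"
| step: "\<lbrakk>u \<in> right_span A; x \<in> A; a \<in> carrier R\<rbrakk> \<Longrightarrow> u \<oplus> x \<otimes> a \<in> right_span A"

lemma right_idealD:
  assumes "right_ideal I"
  shows "I \<subseteq> carrier R" "\<zero> \<in> I" "x \<in> I \<Longrightarrow> y \<in> I \<Longrightarrow> x \<oplus> y \<in> I"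
    "x \<in> I \<Longrightarrow> r \<in> carrier R \<Longrightarrow> x \<otimes> r \<in> I"
    "x \<in> I \<Longrightarrow> \<ominus> x \<in> I" "x \<in> I \<Longrightarrow> y \<in> I \<Longrightarrow> x \<ominus> y \<in> I"
proof -
  show *: "I \<subseteq> carrier R" "\<zero> \<in> I" "x \<in> I \<Longrightarrow> y \<in> I \<Longrightarrow> x \<oplus> y \<in> I"
    "x \<in> I \<Longrightarrow> r \<in> carrier R \<Longrightarrow> x \<otimes> r \<in> I" for x y r
    using assms by (auto simp: right_ideal_def)
  show **: "x \<in> I \<Longrightarrow> \<ominus> x \<in> I" for x
    using *(4)[of x "\<ominus> \<one>"] *(1) by (auto simp: r_minus subset_iff)
  show "x \<in> I \<Longrightarrow> y \<in> I \<Longrightarrow> x \<ominus> y \<in> I"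
    using *(3)[of x "\<ominus> y"] **[of y] by (simp add: a_minus_def)
qed

lemma right_ideal_sum_principal:
  assumes "right_ideal M" "w \<in> carrier R"
  shows "right_ideal {m \<oplus> w \<otimes> t | m t. m \<in> M \<and> t \<in> carrier R}"
proof -
  note M = right_idealD[OF assms(1)]
  let ?S = "{m \<oplus> w \<otimes> t | m t. m \<in> M \<and> t \<in> carrier R}"
  have S: "x \<in> ?S" if "x = m \<oplus> w \<otimes> t" "m \<in> M" "t \<in> carrier R" for x m t
    using that by blast
  show ?thesis
    unfolding right_ideal_def
  proof (intro conjI ballI)
    show "?S \<subseteq> carrier R" using M(1) assms(2) by auto
    show "\<zero> \<in> ?S" by (rule S[of _ \<zero> \<zero>]) (use assms M in auto)
  next
    fix x y assume "x \<in> ?S" "y \<in> ?S"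
    then obtain m1 t1 m2 t2 where xy: "x = m1 \<oplus> w \<otimes> t1" "y = m2 \<oplus> w \<otimes> t2"
      "m1 \<in> M" "m2 \<in> M" "t1 \<in> carrier R" "t2 \<in> carrier R" by blast
    show "x \<oplus> y \<in> ?S"
      by (rule S[of _ "m1 \<oplus> m2" "t1 \<oplus> t2"])
        (use xy M(1,3) assms(2) in \<open>auto simp: r_distr a_ac subset_iff\<close>)
  next
    fix x r assume "x \<in> ?S" and r: "r \<in> carrier R"
    then obtain m1 t1 where x: "x = m1 \<oplus> w \<otimes> t1" "m1 \<in> M" "t1 \<in> carrier R" by blast
    show "x \<otimes> r \<in> ?S"
      by (rule S[of _ "m1 \<otimes> r" "t1 \<otimes> r"])
        (use x r M(1,4) assms(2) in \<open>auto simp: l_distr m_assoc subset_iff\<close>)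
  qed
qed

lemma right_ideal_rann: "F \<subseteq> carrier R \<Longrightarrow> right_ideal (rann F)"
  by (auto simp: right_ideal_def rann_def r_distr subset_iff simp flip: m_assoc)

lemma right_span_subset: "A \<subseteq> carrier R \<Longrightarrow> right_span A \<subseteq> carrier R"
proof
  fix x assume "A \<subseteq> carrier R" "x \<in> right_span A"
  from this(2,1) show "x \<in> carrier R" by induction auto
qed

lemma right_span_least:
  assumes I: "right_ideal I" "A \<subseteq> I"
  shows "right_span A \<subseteq> I"
proof
  fix x assume "x \<in> right_span A"
  then show "x \<in> I"
    by induction (use I in \<open>auto simp: right_idealD subset_iff\<close>)
qed

lemma right_ideal_right_span:
  assumes A: "A \<subseteq> carrier R"
  shows "right_ideal (right_span A)"
proof -
  note sub = right_span_subset[OF A]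
  have add: "y \<oplus> x \<in> right_span A" if x: "x \<in> right_span A" and y: "y \<in> right_span A" for x y
    using x
  proof induction
    case zero
    then show ?case using y sub by auto
  next
    case (step u x a)
    then have "y \<oplus> (u \<oplus> x \<otimes> a) = (y \<oplus> u) \<oplus> x \<otimes> a"
      using y sub A by (auto simp: a_assoc subset_iff)
    then show ?case using step right_span.step by simp
  qed
  have mult: "x \<otimes> r \<in> right_span A" if x: "x \<in> right_span A" and r: "r \<in> carrier R" for x r
    using x
  proof induction
    case zero
    then show ?case using r by (simp add: right_span.zero)
  next
    case (step u x a)
    then have "(u \<oplus> x \<otimes> a) \<otimes> r = u \<otimes> r \<oplus> x \<otimes> (a \<otimes> r)"
      using r sub A by (auto simp: l_distr m_assoc subset_iff)
    then show ?case using step r right_span.step by simp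
  qed
  show ?thesis
    using add mult sub by (auto simp: right_ideal_def right_span.zero)
qed

lemma right_span_superset:
  assumes "A \<subseteq> carrier R"
  shows "A \<subseteq> right_span A"
proof
  fix x assume "x \<in> A"
  then show "x \<in> right_span A"
    using right_span.step[OF right_span.zero, of x A \<one>] assms by auto
qed

section \<open>The right singular ideal\<close>

lemma ess_in_rannD:
  assumes "ess_in (rann {z}) (carrier R)" "a \<in> carrier R" "a \<noteq> \<zero>"
  obtains r where "r \<in> carrier R" "z \<otimes> (a \<otimes> r) = \<zero>" "a \<otimes> r \<noteq> \<zero>"
  using assms unfolding ess_in_def rann_def by auto

text \<open>If \<open>z \<otimes> a = \<zero>\<close> already holds, then \<open>r = \<one>\<close>
  serves.\<close>

lemma right_singularI:
  assumes "z \<in> carrier R"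
    and "\<And>a. \<lbrakk>a \<in> carrier R; z \<otimes> a \<noteq> \<zero>\<rbrakk> \<Longrightarrow> \<exists>r\<in>carrier R. z \<otimes> (a \<otimes> r) = \<zero> \<and> a \<otimes> r \<noteq> \<zero>"
  shows "z \<in> right_singular"
proof -
  have "\<exists>r\<in>carrier R. a \<otimes> r \<in> rann {z} \<and> a \<otimes> r \<noteq> \<zero>" if a: "a \<in> carrier R" "a \<noteq> \<zero>" for a
  proof (cases "z \<otimes> a = \<zero>")
    case True
    then show ?thesis using a by (intro bexI[of _ \<one>]) (auto simp: rann_def)
  next
    case False
    then show ?thesis using assms(2)[OF a(1)] a by (auto simp: rann_def)
  qed
  then show ?thesis
    using assms(1) by (simp add: right_singular_def ess_in_def)
qed

lemma right_singularE:
  assumes "z \<in> right_singular" "a \<in> carrier R" "a \<noteq> \<zero>"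
  obtains r where "r \<in> carrier R" "z \<otimes> (a \<otimes> r) = \<zero>" "a \<otimes> r \<noteq> \<zero>"
  using assms ess_in_rannD unfolding right_singular_def by blast

lemma right_singular_carrier: "z \<in> right_singular \<Longrightarrow> z \<in> carrier R"
  by (simp add: right_singular_def)

lemma right_singular_zero: "\<zero> \<in> right_singular"
  by (rule right_singularI) auto

text \<open>Essential right ideals have essential intersection: \<open>a\<close> is moved into the
  annihilator of \<open>y\<close> and then, still nonzero, into that of \<open>z\<close>.\<close>

lemma right_singular_add:
  assumes "y \<in> right_singular" "z \<in> right_singular"
  shows "y \<oplus> z \<in> right_singular"
proof (rule right_singularI)
  have yz: "y \<in> carrier R" "z \<in> carrier R"
    using assms right_singular_carrier by auto
  then show "y \<oplus> z \<in> carrier R" by simp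
  fix a assume a: "a \<in> carrier R" "(y \<oplus> z) \<otimes> a \<noteq> \<zero>"
  then have "a \<noteq> \<zero>" using yz by auto
  then obtain r where r: "r \<in> carrier R" "y \<otimes> (a \<otimes> r) = \<zero>" "a \<otimes> r \<noteq> \<zero>"
    using right_singularE[OF assms(1) a(1)] by blast
  then obtain s where s: "s \<in> carrier R" "z \<otimes> (a \<otimes> r \<otimes> s) = \<zero>" "a \<otimes> r \<otimes> s \<noteq> \<zero>"
    using right_singularE[OF assms(2), of "a \<otimes> r"] a by auto
  have "y \<otimes> (a \<otimes> (r \<otimes> s)) = y \<otimes> (a \<otimes> r) \<otimes> s"
    using yz a(1) r(1) s(1) by (simp add: m_assoc)
  then have "y \<otimes> (a \<otimes> (r \<otimes> s)) = \<zero>" using r s by simp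
  then show "\<exists>r\<in>carrier R. (y \<oplus> z) \<otimes> (a \<otimes> r) = \<zero> \<and> a \<otimes> r \<noteq> \<zero>"
    using yz a r s by (intro bexI[of _ "r \<otimes> s"]) (auto simp: l_distr m_assoc)
qed

lemma right_singular_lmult:
  assumes "z \<in> right_singular" "q \<in> carrier R"
  shows "q \<otimes> z \<in> right_singular"
proof (rule right_singularI)
  have z: "z \<in> carrier R"
    using assms right_singular_carrier by auto
  then show "q \<otimes> z \<in> carrier R" using assms by simp
  fix a assume a: "a \<in> carrier R" "q \<otimes> z \<otimes> a \<noteq> \<zero>"
  then have "a \<noteq> \<zero>" using z assms by auto
  then obtain r where "r \<in> carrier R" "z \<otimes> (a \<otimes> r) = \<zero>" "a \<otimes> r \<noteq> \<zero>"
    using right_singularE[OF assms(1) a(1)] by blast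
  then show "\<exists>r\<in>carrier R. q \<otimes> z \<otimes> (a \<otimes> r) = \<zero> \<and> a \<otimes> r \<noteq> \<zero>"
    using z a assms by (intro bexI[of _ "r"]) (auto simp: m_assoc)
qed

text \<open>The annihilator of \<open>z \<otimes> q\<close> is the preimage of that of
  \<open>z\<close> under left multiplication by \<open>q\<close>, so essentiality is applied to
  \<open>q \<otimes> a\<close>.\<close>

lemma right_singular_rmult:
  assumes "z \<in> right_singular" "q \<in> carrier R"
  shows "z \<otimes> q \<in> right_singular"
proof (rule right_singularI)
  have z: "z \<in> carrier R"
    using assms right_singular_carrier by auto
  then show "z \<otimes> q \<in> carrier R" using assms by simp
  fix a assume a: "a \<in> carrier R" "z \<otimes> q \<otimes> a \<noteq> \<zero>"
  then have "q \<otimes> a \<noteq> \<zero>" using z assms by (auto simp: m_assoc)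
  then obtain r where r: "r \<in> carrier R" "z \<otimes> (q \<otimes> a \<otimes> r) = \<zero>" "q \<otimes> a \<otimes> r \<noteq> \<zero>"
    using right_singularE[OF assms(1), of "q \<otimes> a"] a assms by auto
  then have "a \<otimes> r \<noteq> \<zero>" using a assms by (auto simp: m_assoc)
  then show "\<exists>r\<in>carrier R. z \<otimes> q \<otimes> (a \<otimes> r) = \<zero> \<and> a \<otimes> r \<noteq> \<zero>"
    using z a assms r by (intro bexI[of _ "r"]) (auto simp: m_assoc)
qed

lemma right_ideal_right_singular: "right_ideal right_singular"
  by (auto simp: right_ideal_def right_singular_zero right_singular_add right_singular_rmult
      right_singular_carrier)

text \<open>A map \<open>eR \<rightarrow> R\<close> that vanishes on an essential submodule is left multiplication by a singular
  element.\<close>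

lemma right_singular_if_kills_essential:
  assumes "ess_in N {e \<otimes> r | r. r \<in> carrier R}" "e \<in> carrier R" "q \<in> carrier R"
    and kill: "\<And>n. n \<in> N \<Longrightarrow> q \<otimes> n = \<zero>"
  shows "q \<otimes> e \<in> right_singular"
proof (rule right_singularI)
  show "q \<otimes> e \<in> carrier R" using assms by simp
  fix a assume a: "a \<in> carrier R" "q \<otimes> e \<otimes> a \<noteq> \<zero>"
  then have "e \<otimes> a \<noteq> \<zero>" using assms(2,3) by (auto simp: m_assoc)
  then obtain r where r: "r \<in> carrier R" "e \<otimes> a \<otimes> r \<in> N" "e \<otimes> a \<otimes> r \<noteq> \<zero>"
    using assms(1) a unfolding ess_in_def by blast
  then show "\<exists>r\<in>carrier R. q \<otimes> e \<otimes> (a \<otimes> r) = \<zero> \<and> a \<otimes> r \<noteq> \<zero>"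
    using a kill[OF r(2)] assms(2,3) by (intro bexI[of _ r]) (auto simp: m_assoc)
qed

section \<open>Simple right ideals\<close>

lemma rannD: "r \<in> rann {x} \<longleftrightarrow> r \<in> carrier R \<and> x \<otimes> r = \<zero>"
  by (auto simp: rann_def)

lemma simple_genD:
  assumes "simple_gen x"
  shows "x \<in> carrier R" "x \<noteq> \<zero>" "\<lbrakk>w \<in> carrier R; x \<otimes> w \<noteq> \<zero>\<rbrakk> \<Longrightarrow> \<exists>t\<in>carrier R. x \<otimes> w \<otimes> t = x"
  using assms by (auto simp: simple_gen_def)

lemma simple_gen_mult:
  assumes x: "simple_gen x" and w: "w \<in> carrier R" "x \<otimes> w \<noteq> \<zero>"
  shows "simple_gen (x \<otimes> w)"
  unfolding simple_gen_def
proof (intro conjI ballI impI)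
  fix v assume v: "v \<in> carrier R" "x \<otimes> w \<otimes> v \<noteq> \<zero>"
  then obtain t where t: "t \<in> carrier R" "x \<otimes> (w \<otimes> v) \<otimes> t = x"
    using simple_genD(3)[OF x, of "w \<otimes> v"] w simple_genD(1)[OF x] by (auto simp: m_assoc)
  then have "x \<otimes> w \<otimes> v \<otimes> (t \<otimes> w) = x \<otimes> w"
    using w v simple_genD(1)[OF x] by (simp flip: m_assoc)
  then show "\<exists>t\<in>carrier R. x \<otimes> w \<otimes> v \<otimes> t = x \<otimes> w"
    using t w by (intro bexI[of _ "t \<otimes> w"]) auto
qed (use w simple_genD(1)[OF x] in auto)

text \<open>The equation \<open>x \<otimes> v = x\<close> puts \<open>v \<ominus> \<one>\<close>
  into \<open>rann {x}\<close>, and so passes along an inclusion of annihilators.\<close>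

lemma eq_rann_cancel:
  assumes "rann {x} \<subseteq> rann {y}" "x \<in> carrier R" "y \<in> carrier R" "v \<in> carrier R" "x \<otimes> v = x"
  shows "y \<otimes> v = y"
proof -
  have "x \<otimes> (v \<ominus> \<one>) = \<zero>"
    using assms by (simp add: a_minus_def r_distr r_minus r_neg)
  then have "y \<otimes> (v \<ominus> \<one>) = \<zero>"
    using assms by (auto simp: rannD subset_iff)
  then have "y \<otimes> v \<ominus> y = \<zero>"
    using assms by (simp add: a_minus_def r_distr r_minus)
  then show ?thesis
    using assms r_right_minus_eq by simp
qed

text \<open>By \<open>sub\<close> there is a map from \<open>xR\<close> onto \<open>yR\<close>
  sending \<open>x\<close> to \<open>y\<close>. It is nonzero on a simple module, hence
  injective.\<close>

lemma simple_gen_rann_eqI: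
  assumes x: "simple_gen x" and y: "y \<in> carrier R" "y \<noteq> \<zero>" and sub: "rann {x} \<subseteq> rann {y}"
  shows "rann {x} = rann {y}"
proof (rule ccontr)
  note x' = simple_genD[OF x]
  assume "rann {x} \<noteq> rann {y}"
  then obtain w where w: "w \<in> carrier R" "y \<otimes> w = \<zero>" "x \<otimes> w \<noteq> \<zero>"
    using sub unfolding set_eq_iff rannD subset_iff by blast
  then obtain t where t: "t \<in> carrier R" "x \<otimes> w \<otimes> t = x"
    using x'(3) by blast
  then have "y \<otimes> (w \<otimes> t) = y"
    using eq_rann_cancel[OF sub] w x' y by (simp add: m_assoc)
  then show False
    using w y t by (simp flip: m_assoc)
qed

text \<open>Since \<open>xR\<close> is isomorphic to R modulo \<open>rann {x}\<close>, simplicity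
  depends on the annihilator alone.\<close>

lemma simple_gen_cong:
  assumes x: "simple_gen x" and y: "y \<in> carrier R" and eq: "rann {x} = rann {y}"
  shows "simple_gen y"
  unfolding simple_gen_def
proof (intro conjI ballI impI)
  note x' = simple_genD[OF x]
  show "y \<noteq> \<zero>"
  proof
    assume "y = \<zero>"
    then have "\<one> \<in> rann {x}" unfolding eq by (simp add: rannD)
    then show False using x' by (simp add: rannD)
  qed
  fix w assume w: "w \<in> carrier R" "y \<otimes> w \<noteq> \<zero>"
  then have "w \<notin> rann {x}" unfolding eq by (simp add: rannD)
  then obtain t where t: "t \<in> carrier R" "x \<otimes> w \<otimes> t = x"
    using x'(3)[of w] w by (auto simp: rannD)
  then have "y \<otimes> (w \<otimes> t) = y"
    using eq_rann_cancel[of x y "w \<otimes> t"] eq w x' y by (simp add: m_assoc)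
  then show "\<exists>t\<in>carrier R. y \<otimes> w \<otimes> t = y"
    using w y t by (auto simp flip: m_assoc)
qed (use y in auto)

text \<open>Half of Schur's lemma: left multiplication by \<open>q\<close> is right linear and
  nonzero on the simple module \<open>xR\<close>, hence injective.\<close>

lemma simple_gen_lmult:
  assumes x: "simple_gen x" and q: "q \<in> carrier R" "q \<otimes> x \<noteq> \<zero>"
  shows "rann {q \<otimes> x} = rann {x}" "simple_gen (q \<otimes> x)"
proof -
  note x' = simple_genD[OF x]
  have "rann {x} \<subseteq> rann {q \<otimes> x}"
    using x'(1) q by (auto simp: rannD m_assoc)
  then show "rann {q \<otimes> x} = rann {x}"
    using simple_gen_rann_eqI[OF x, of "q \<otimes> x"] q x' by auto
  then show "simple_gen (q \<otimes> x)"
    using simple_gen_cong[OF x, of "q \<otimes> x"] q x' by auto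
qed

lemma rann_mult_cong:
  assumes "rann {x} = rann {y}" "x \<in> carrier R" "y \<in> carrier R" "r \<in> carrier R"
  shows "rann {x \<otimes> r} = rann {y \<otimes> r}"
proof -
  have "x \<otimes> (r \<otimes> s) = \<zero> \<longleftrightarrow> y \<otimes> (r \<otimes> s) = \<zero>" if "s \<in> carrier R" for s
    using assms that rannD[of "r \<otimes> s" x] rannD[of "r \<otimes> s" y] by auto
  then show ?thesis
    using assms by (auto simp: rannD m_assoc)
qed

lemma simple_equiv_refl: "x \<in> carrier R \<Longrightarrow> simple_equiv x x"
  unfolding simple_equiv_def by (intro bexI[of _ \<one>]) auto

lemma simple_equiv_sym:
  assumes x: "simple_gen x" and y: "simple_gen y" and xy: "simple_equiv x y"
  shows "simple_equiv y x"
proof -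
  note x' = simple_genD[OF x] and y' = simple_genD[OF y]
  obtain a where a: "a \<in> carrier R" "rann {y \<otimes> a} = rann {x}"
    using xy by (auto simp: simple_equiv_def)
  have "y \<otimes> a \<noteq> \<zero>"
    using simple_gen_cong[OF x, of "y \<otimes> a"] a y' simple_genD(2) by auto
  \<comment> \<open>The factor \<open>s\<close> undoes \<open>a\<close>: the isomorphism sending
    \<open>y \<otimes> a\<close> to \<open>x\<close> sends \<open>y\<close> to
    \<open>x \<otimes> s\<close>.\<close>
  then obtain s where s: "s \<in> carrier R" "y \<otimes> a \<otimes> s = y"
    using y'(3) a by blast
  have "rann {x \<otimes> s} = rann {y}"
    using rann_mult_cong[of "y \<otimes> a" x s] s a x' y' by simp
  then show ?thesis
    using s by (auto simp: simple_equiv_def)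
qed

lemma simple_equiv_trans:
  assumes "x \<in> carrier R" "y \<in> carrier R" "z \<in> carrier R" "simple_equiv x y" "simple_equiv y z"
  shows "simple_equiv x z"
proof -
  obtain a b where a: "a \<in> carrier R" "rann {y \<otimes> a} = rann {x}"
    and b: "b \<in> carrier R" "rann {z \<otimes> b} = rann {y}"
    using assms by (auto simp: simple_equiv_def)
  have "rann {z \<otimes> b \<otimes> a} = rann {y \<otimes> a}"
    by (rule rann_mult_cong) (use a b assms in auto)
  then show ?thesis
    unfolding simple_equiv_def using a b assms by (intro bexI[of _ "b \<otimes> a"]) (auto simp: m_assoc)
qed

text \<open>Either the last summand of a simple element \<open>w\<close> vanishes, or it generates a
  copy of \<open>wR\<close>, or some \<open>s\<close> kills it but not \<open>w\<close>, and then
  \<open>w\<close> is a multiple of the shorter sum \<open>u\<close>.\<close>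

lemma simple_in_right_span:
  assumes A: "\<And>x. x \<in> A \<Longrightarrow> simple_gen x" and y: "y \<in> right_span A" "simple_gen y"
  shows "\<exists>x\<in>A. simple_equiv y x"
proof -
  have Ac: "A \<subseteq> carrier R" using A simple_genD by auto
  \<comment> \<open>Claimed for all multiples of \<open>y\<close>, because the induction hypothesis
    is applied to multiples of \<open>u\<close>.\<close>
  have "\<forall>t\<in>carrier R. simple_gen (y \<otimes> t) \<longrightarrow> (\<exists>x\<in>A. simple_equiv (y \<otimes> t) x)"
    using y(1)
  proof induction
    case zero
    then show ?case by (auto simp: simple_gen_def)
  next
    case (step u x a)
    note u = subsetD[OF right_span_subset[OF Ac] step(1)]
    note x = simple_genD[OF A[OF step(2)]]
    show ?case
    proof (intro ballI impI)
      fix t assume t: "t \<in> carrier R" and min: "simple_gen ((u \<oplus> x \<otimes> a) \<otimes> t)"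
      define w where "w = (u \<oplus> x \<otimes> a) \<otimes> t"
      have w: "w \<in> carrier R" "w \<noteq> \<zero>" "simple_gen w"
        using min simple_genD unfolding w_def by auto
      have wdef: "w = u \<otimes> t \<oplus> x \<otimes> (a \<otimes> t)"
        using u x step t by (simp add: w_def l_distr m_assoc)
      show "\<exists>z\<in>A. simple_equiv ((u \<oplus> x \<otimes> a) \<otimes> t) z"
      proof (cases "x \<otimes> (a \<otimes> t) = \<zero>")
        case True
        then have "w = u \<otimes> t" using wdef u t by simp
        then show ?thesis using step.IH t w by (simp add: w_def)
      next
        case False
        then have at: "simple_gen (x \<otimes> (a \<otimes> t))"
          using simple_gen_mult[OF A[OF step(2)]] step t by simp
        show ?thesis
        proof (cases "rann {x \<otimes> (a \<otimes> t)} \<subseteq> rann {w}")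
          case True
          then have "rann {x \<otimes> (a \<otimes> t)} = rann {w}"
            using simple_gen_rann_eqI[OF at] w by blast
          then show ?thesis
            unfolding simple_equiv_def w_def[symmetric] using step t by auto
        next
          case False
          then obtain s where s: "s \<in> carrier R" "x \<otimes> (a \<otimes> t) \<otimes> s = \<zero>" "w \<otimes> s \<noteq> \<zero>"
            unfolding subset_iff rannD by blast
          then obtain v where v: "v \<in> carrier R" "w \<otimes> s \<otimes> v = w"
            using simple_genD(3)[OF w(3)] by blast
          have "w \<otimes> s = u \<otimes> t \<otimes> s"
            using wdef u x step t s by (simp add: l_distr)
          then have "w = u \<otimes> (t \<otimes> s \<otimes> v)"
            using v u t s by (simp add: m_assoc)
          then show ?thesis
            using step.IH t s v w by (simp add: w_def)
        qed
      qed
    qed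
  qed
  from bspec[OF this one_closed] show ?thesis
    using simple_genD(1)[OF y(2)] y(2) by simp
qed

text \<open>The essential right ideal \<open>rann {z}\<close> meets \<open>xR\<close> nontrivially,
  hence contains it by simplicity.\<close>

lemma singular_kills_simple:
  assumes "z \<in> right_singular" "simple_gen x"
  shows "z \<otimes> x = \<zero>"
proof -
  note x = simple_genD[OF assms(2)] and z = right_singular_carrier[OF assms(1)]
  obtain r where r: "r \<in> carrier R" "z \<otimes> (x \<otimes> r) = \<zero>" "x \<otimes> r \<noteq> \<zero>"
    using right_singularE[OF assms(1) x(1,2)] by blast
  then obtain t where t: "t \<in> carrier R" "x \<otimes> r \<otimes> t = x"
    using x by blast
  have "z \<otimes> (x \<otimes> r \<otimes> t) = z \<otimes> (x \<otimes> r) \<otimes> t"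
    using t(1) x(1) z r(1) by (simp add: m_assoc)
  then show ?thesis using r t by simp
qed

end

section \<open>Closures of singular semisimple right ideals\<close>

text \<open>The form in which the hypotheses on the ring enter: \<open>left_inverse\<close> comes
  from GC2, \<open>right_annihilator\<close> from CF, and the last assumption from either CS
  condition.\<close>

locale cf_gc2_ring = ring +
  assumes left_inverse: "\<lbrakk>a \<in> carrier R; rann {a} = {\<zero>}\<rbrakk> \<Longrightarrow> \<exists>b\<in>carrier R. b \<otimes> a = \<one>"
    and right_annihilator: "right_ideal I \<Longrightarrow> \<exists>F. finite F \<and> F \<subseteq> carrier R \<and> I = rann F"
    and singular_semisimple_closure:
      "(\<And>x. x \<in> A \<Longrightarrow> simple_gen x \<and> x \<in> right_singular) \<Longrightarrow>
        \<exists>e\<in>carrier R. e \<otimes> e = e \<and> (\<forall>n\<in>right_span A. e \<otimes> n = n) \<and>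
          ess_in (right_span A) {e \<otimes> r | r. r \<in> carrier R}"
begin

text \<open>The left inverse \<open>s\<close> of \<open>\<one> \<ominus> z\<close> equals
  \<open>\<one> \<oplus> s \<otimes> z\<close>, again one minus a singular element. So
  \<open>s\<close> has a left inverse too, which must be \<open>\<one> \<ominus> z\<close>.\<close>

lemma one_minus_singular_unit:
  assumes z: "z \<in> right_singular"
  shows "\<exists>s\<in>carrier R. (\<one> \<ominus> z) \<otimes> s = \<one>"
proof -
  have left: "\<exists>s\<in>carrier R. s \<otimes> (\<one> \<ominus> z) = \<one>" if z: "z \<in> right_singular" for z
  proof (rule left_inverse)
    note zc = right_singular_carrier[OF z]
    then show c: "\<one> \<ominus> z \<in> carrier R" by simp
    have "a = \<zero>" if a: "a \<in> carrier R" "(\<one> \<ominus> z) \<otimes> a = \<zero>" for a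
    proof (rule ccontr)
      assume "a \<noteq> \<zero>"
      then obtain r where r: "r \<in> carrier R" "z \<otimes> (a \<otimes> r) = \<zero>" "a \<otimes> r \<noteq> \<zero>"
        using right_singularE[OF z a(1)] by blast
      have "(\<one> \<ominus> z) \<otimes> (a \<otimes> r) = (\<one> \<ominus> z) \<otimes> a \<otimes> r"
        using a(1) r(1) c by (simp add: m_assoc)
      then have "(\<one> \<ominus> z) \<otimes> (a \<otimes> r) = \<zero>" using a r by simp
      then have "a \<otimes> r \<ominus> z \<otimes> (a \<otimes> r) = \<zero>"
        using a(1) r(1) zc by (simp add: a_minus_def l_distr l_minus)
      then show False using r a by (simp add: a_minus_def)
    qed
    then show "rann {\<one> \<ominus> z} = {\<zero>}" using c by (auto simp: rannD)
  qed
  note zc = right_singular_carrier[OF z]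
  obtain s where s: "s \<in> carrier R" "s \<otimes> (\<one> \<ominus> z) = \<one>"
    using left[OF z] by blast
  have "s \<ominus> s \<otimes> z = \<one>"
    using s zc by (simp add: a_minus_def r_distr r_minus)
  then have s': "s = \<one> \<ominus> \<ominus> (s \<otimes> z)"
    using s zc by (metis a_minus_def local.minus_minus m_closed add.inv_solve_right one_closed)
  obtain t where t: "t \<in> carrier R" "t \<otimes> s = \<one>"
    using left[of "\<ominus> (s \<otimes> z)"] s' right_singular_lmult[OF z s(1)]
      right_idealD(5)[OF right_ideal_right_singular] by auto
  have "t = t \<otimes> (s \<otimes> (\<one> \<ominus> z))"
    using s t by simp
  also have "\<dots> = \<one> \<ominus> z"
    using s(1) t zc by (simp flip: m_assoc)
  finally show ?thesis using s t by auto
qed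

text \<open>Singular elements lie in the Jacobson radical: if
  \<open>x \<otimes> z \<otimes> t = x\<close>, then \<open>x\<close> annihilates the right
  invertible element \<open>\<one> \<ominus> z \<otimes> t\<close>.\<close>

lemma simple_kills_singular:
  assumes x: "simple_gen x" and z: "z \<in> right_singular"
  shows "x \<otimes> z = \<zero>"
proof (rule ccontr)
  note x' = simple_genD[OF x] and zc = right_singular_carrier[OF z]
  assume "x \<otimes> z \<noteq> \<zero>"
  then obtain t where t: "t \<in> carrier R" "x \<otimes> z \<otimes> t = x"
    using x' zc by blast
  obtain s where s: "s \<in> carrier R" "(\<one> \<ominus> z \<otimes> t) \<otimes> s = \<one>"
    using one_minus_singular_unit[of "z \<otimes> t"] right_singular_rmult[OF z t(1)] by blast
  have "x \<otimes> (\<one> \<ominus> z \<otimes> t) = x \<ominus> x \<otimes> z \<otimes> t"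
    using x' zc t(1) by (simp add: a_minus_def r_distr r_minus m_assoc)
  then have "x \<otimes> (\<one> \<ominus> z \<otimes> t) = \<zero>"
    using t x' by (simp add: a_minus_def r_neg)
  then have "x \<otimes> ((\<one> \<ominus> z \<otimes> t) \<otimes> s) = \<zero>"
    using x'(1) zc t(1) s(1) by (simp flip: m_assoc)
  then show False using s x' by simp
qed

text \<open>A maximal right ideal \<open>M\<close> above \<open>Q\<close> is the annihilator of a
  finite set \<open>F\<close>. Any nonzero \<open>x\<close> in \<open>F\<close> has a proper
  annihilator containing \<open>M\<close>, hence equal to \<open>M\<close>, so \<open>xR\<close> is
  a copy of the simple module R/M.\<close>

lemma simple_gen_containing:
  assumes Q: "right_ideal Q" "\<one> \<notin> Q"
  shows "\<exists>x. simple_gen x \<and> Q \<subseteq> rann {x}"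
proof -
  let ?P = "{I. right_ideal I \<and> \<one> \<notin> I \<and> Q \<subseteq> I}"
  have "\<exists>M\<in>?P. \<forall>U\<in>?P. M \<subseteq> U \<longrightarrow> U = M"
  proof (rule subset_Zorn_nonempty)
    show "?P \<noteq> {}" using Q by blast
    fix C assume C: "C \<noteq> {}" "subset.chain ?P C"
    then have sub: "C \<subseteq> ?P" and tot: "\<And>I J. I \<in> C \<Longrightarrow> J \<in> C \<Longrightarrow> I \<subseteq> J \<or> J \<subseteq> I"
      by (auto simp: subset_chain_def)
    have ideal: "right_ideal I" if "I \<in> C" for I using sub that by auto
    have add: "x \<oplus> y \<in> \<Union>C" if IJ: "I \<in> C" "J \<in> C" "x \<in> I" "y \<in> J" for x y I J
      using tot[OF IJ(1,2)]
    proof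
      assume "I \<subseteq> J"
      then show ?thesis using right_idealD(3)[OF ideal[OF IJ(2)]] IJ by blast
    next
      assume "J \<subseteq> I"
      then show ?thesis using right_idealD(3)[OF ideal[OF IJ(1)]] IJ by blast
    qed
    obtain I where "I \<in> C" using C(1) by blast
    then have "\<zero> \<in> \<Union>C" using right_idealD(2)[OF ideal] by blast
    moreover have "\<Union>C \<subseteq> carrier R" using right_idealD(1)[OF ideal] by blast
    moreover have "x \<otimes> r \<in> \<Union>C" if "x \<in> \<Union>C" "r \<in> carrier R" for x r
      using that right_idealD(4)[OF ideal] by blast
    ultimately have "right_ideal (\<Union>C)"
      using add unfolding right_ideal_def by blast
    then show "\<Union>C \<in> ?P"
      using sub C(1) by blast
  qed
  then obtain M where M0: "M \<in> ?P" and max0: "\<forall>U\<in>?P. M \<subseteq> U \<longrightarrow> U = M"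
    by (rule bexE)
  have M: "right_ideal M" "\<one> \<notin> M" "Q \<subseteq> M"
    using M0 by auto
  have max: "U = M" if "right_ideal U" "\<one> \<notin> U" "M \<subseteq> U" for U
  proof -
    have U: "U \<in> ?P" using that(1,2) subset_trans[OF M(3) that(3)] by simp
    show ?thesis by (rule mp[OF bspec[OF max0 U] that(3)])
  qed
  obtain F where F: "F \<subseteq> carrier R" "M = rann F"
    using right_annihilator[OF M(1)] by blast
  then obtain x where x: "x \<in> F" "x \<noteq> \<zero>"
    using M(2) by (auto simp: rann_def)
  have "right_ideal (rann {x})" using x F right_ideal_rann[of "{x}"] by blast
  moreover have "\<one> \<notin> rann {x}" using x F by (auto simp: rannD)
  moreover have "M \<subseteq> rann {x}" using x F(2) by (auto simp: rann_def)
  ultimately have xM: "rann {x} = M" by (rule max)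
  have "simple_gen x"
    unfolding simple_gen_def
  proof (intro conjI ballI impI)
    show xc: "x \<in> carrier R" using x F by auto
    fix w assume w: "w \<in> carrier R" "x \<otimes> w \<noteq> \<zero>"
    \<comment> \<open>As \<open>w\<close> lies outside \<open>M\<close>, this right ideal contains
      \<open>\<one>\<close>, and the resulting decomposition of \<open>\<one>\<close> yields
      \<open>t\<close>.\<close>
    let ?I = "{m \<oplus> w \<otimes> t | m t. m \<in> M \<and> t \<in> carrier R}"
    have inI: "m \<oplus> w \<otimes> t \<in> ?I" if "m \<in> M" "t \<in> carrier R" for m t
      using that by blast
    note Mc = right_idealD[OF M(1)]
    have sub: "M \<subseteq> ?I"
    proof
      fix m assume m: "m \<in> M"
      then have "m \<in> carrier R" using Mc(1) by auto
      then show "m \<in> ?I" using inI[OF m zero_closed] w by simp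
    qed
    have "w \<in> ?I"
      using inI[OF Mc(2) one_closed] w by simp
    moreover have "w \<notin> M"
      using w xM by (auto simp: rannD)
    ultimately have "?I \<noteq> M" by auto
    then have "\<one> \<in> ?I"
      using max[OF right_ideal_sum_principal[OF M(1) w(1)]] sub by blast
    then obtain m t where mt: "m \<in> M" "t \<in> carrier R" "\<one> = m \<oplus> w \<otimes> t" by blast
    have m: "m \<in> carrier R" "x \<otimes> m = \<zero>" using mt xM by (auto simp: rannD)
    have "x = x \<otimes> (m \<oplus> w \<otimes> t)" using xc by (simp flip: mt(3))
    also have "\<dots> = x \<otimes> w \<otimes> t" using xc w(1) mt(2) m by (simp add: r_distr m_assoc)
    finally show "\<exists>t\<in>carrier R. x \<otimes> w \<otimes> t = x" using mt(2) by metis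
  qed (use x in auto)
  then show ?thesis using M xM by auto
qed

section \<open>Representatives of the singular simple right ideals and their closures\<close>

definition singular_simples :: "'a set" where
  "singular_simples = {x. simple_gen x \<and> x \<in> right_singular}"

text \<open>On singular simples the candidates \<open>y\<close> depend only on the isomorphism class
  of \<open>x\<close>, so isomorphic ideals receive the very same representative.\<close>

definition simple_rep :: "'a \<Rightarrow> 'a" where
  "simple_rep x = (SOME y. y \<in> singular_simples \<and> simple_equiv x y)"

text \<open>This is \<Lambda> of the overview.\<close>

definition simple_reps :: "'a set" where
  "simple_reps = simple_rep ` singular_simples"

text \<open>This is \<open>e\<^sub>A\<close> of the overview;
  \<open>singular_semisimple_closure\<close> supplies a witness when \<open>A\<close> consists of
  singular simples.\<close>

definition closure_idem :: "'a set \<Rightarrow> 'a" where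
  "closure_idem A = (SOME e. e \<in> carrier R \<and> e \<otimes> e = e \<and> (\<forall>n\<in>right_span A. e \<otimes> n = n) \<and>
     ess_in (right_span A) {e \<otimes> r | r. r \<in> carrier R})"

lemma singular_simplesD:
  assumes "x \<in> singular_simples"
  shows "simple_gen x" "x \<in> right_singular" "x \<in> carrier R"
  using assms by (auto simp: singular_simples_def simple_genD)

lemma simple_rep:
  assumes "x \<in> singular_simples"
  shows "simple_rep x \<in> singular_simples" "simple_equiv x (simple_rep x)"
proof -
  have "\<exists>y. y \<in> singular_simples \<and> simple_equiv x y"
    using assms simple_equiv_refl singular_simplesD by blast
  from someI_ex[OF this] show "simple_rep x \<in> singular_simples" "simple_equiv x (simple_rep x)"
    by (auto simp: simple_rep_def)
qed

lemma simple_reps_singular: "x \<in> simple_reps \<Longrightarrow> x \<in> singular_simples"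
  using simple_rep by (auto simp: simple_reps_def)

lemma simple_reps_unique:
  assumes "x \<in> simple_reps" "y \<in> simple_reps" "simple_equiv x y"
  shows "x = y"
proof -
  obtain x' y' where x': "x' \<in> singular_simples" "x = simple_rep x'"
    and y': "y' \<in> singular_simples" "y = simple_rep y'"
    using assms by (auto simp: simple_reps_def)
  note c = singular_simplesD(1,3)[OF x'(1)] singular_simplesD(1,3)[OF y'(1)]
    singular_simplesD(1,3)[OF simple_reps_singular[OF assms(1)]]
    singular_simplesD(1,3)[OF simple_reps_singular[OF assms(2)]]
  have "simple_equiv x' x" "simple_equiv y' y"
    using simple_rep x' y' by auto
  then have "simple_equiv x' y'" "simple_equiv y' x'"
    using simple_equiv_trans simple_equiv_sym c assms(3) by meson+
  then have "(z \<in> singular_simples \<and> simple_equiv x' z) \<longleftrightarrow> (z \<in> singular_simples \<and> simple_equiv y' z)" for z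
    using simple_equiv_trans c singular_simplesD(3) by meson
  then show ?thesis
    unfolding x'(2) y'(2) simple_rep_def by presburger
qed

lemma closure_idem:
  assumes "A \<subseteq> singular_simples"
  shows "closure_idem A \<in> carrier R" "\<And>n. n \<in> right_span A \<Longrightarrow> closure_idem A \<otimes> n = n"
    "ess_in (right_span A) {closure_idem A \<otimes> r | r. r \<in> carrier R}"
    "closure_idem A \<otimes> closure_idem A = closure_idem A"
proof -
  have "\<exists>e. e \<in> carrier R \<and> e \<otimes> e = e \<and> (\<forall>n\<in>right_span A. e \<otimes> n = n) \<and>
     ess_in (right_span A) {e \<otimes> r | r. r \<in> carrier R}"
    using singular_semisimple_closure[of A] assms by (auto simp: singular_simples_def)
  from someI_ex[OF this] show "closure_idem A \<in> carrier R"
    "\<And>n. n \<in> right_span A \<Longrightarrow> closure_idem A \<otimes> n = n"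
    "ess_in (right_span A) {closure_idem A \<otimes> r | r. r \<in> carrier R}"
    "closure_idem A \<otimes> closure_idem A = closure_idem A"
    unfolding closure_idem_def by blast+
qed

lemma closure_idem_fix:
  assumes "A \<subseteq> singular_simples" "x \<in> A"
  shows "closure_idem A \<otimes> x = x"
  using closure_idem(2)[OF assms(1)] right_span_superset[of A] assms singular_simplesD(3) by blast

lemma kills_right_span:
  assumes "A \<subseteq> carrier R" "q \<in> carrier R" "\<And>x. x \<in> A \<Longrightarrow> q \<otimes> x = \<zero>" "n \<in> right_span A"
  shows "q \<otimes> n = \<zero>"
proof -
  have "right_span A \<subseteq> rann {q}"
    by (rule right_span_least) (use assms right_ideal_rann[of "{q}"] in \<open>auto simp: rannD\<close>)
  then show ?thesis using assms(4) by (auto simp: rannD)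
qed

text \<open>If nonzero, the product generates a copy of \<open>bR\<close> inside
  \<open>e\<^sub>A R\<close>. It meets the essential span of \<open>A\<close>, hence lies in it, so
  \<open>b\<close> is isomorphic to a member of \<open>A\<close> and thus equal to it.\<close>

lemma closure_idem_kills:
  assumes A: "A \<subseteq> simple_reps" and b: "b \<in> simple_reps" "b \<notin> A" and r: "r \<in> carrier R"
  shows "closure_idem A \<otimes> r \<otimes> b = \<zero>"
proof (rule ccontr)
  have AS: "A \<subseteq> singular_simples" using A simple_reps_singular by auto
  note e = closure_idem[OF AS] and bS = singular_simplesD[OF simple_reps_singular[OF b(1)]]
  let ?y = "closure_idem A \<otimes> r \<otimes> b"
  assume y: "?y \<noteq> \<zero>"
  have yb: "rann {?y} = rann {b}" "simple_gen ?y"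
    using simple_gen_lmult[OF bS(1), of "closure_idem A \<otimes> r"] y r e by auto
  have "?y \<in> {closure_idem A \<otimes> r | r. r \<in> carrier R}"
    using r bS e m_assoc by blast
  then obtain s where s: "s \<in> carrier R" "?y \<otimes> s \<in> right_span A" "?y \<otimes> s \<noteq> \<zero>"
    using e(3) y unfolding ess_in_def by blast
  then obtain t where t: "t \<in> carrier R" "?y \<otimes> s \<otimes> t = ?y"
    using simple_genD(3)[OF yb(2)] by blast
  have "?y \<in> right_span A"
    using right_idealD(4)[OF right_ideal_right_span, of A "?y \<otimes> s" t] s t AS singular_simplesD(3)
    by (metis subsetI subset_iff)
  then obtain x where x: "x \<in> A" "simple_equiv ?y x"
    using simple_in_right_span[of A ?y] yb(2) AS singular_simplesD(1) by blast
  then have "simple_equiv b x"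
    using yb by (simp add: simple_equiv_def)
  then show False
    using simple_reps_unique[OF b(1)] x A b(2) by blast
qed

text \<open>Left multiplication by \<open>e\<^sub>A r\<close> kills each member of \<open>B\<close>,
  hence an essential submodule of \<open>e\<^sub>B R\<close>.\<close>

lemma closure_idem_disjoint:
  assumes A: "A \<subseteq> simple_reps" and B: "B \<subseteq> simple_reps" and AB: "A \<inter> B = {}" and r: "r \<in> carrier R"
  shows "closure_idem A \<otimes> r \<otimes> closure_idem B \<in> right_singular"
proof -
  have S: "A \<subseteq> singular_simples" "B \<subseteq> singular_simples" using A B simple_reps_singular by auto
  note e = closure_idem[OF S(1)] and f = closure_idem[OF S(2)]
  show ?thesis
  proof (rule right_singular_if_kills_essential[OF f(3,1)])
    show "closure_idem A \<otimes> r \<in> carrier R" using e r by simp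
    fix n assume n: "n \<in> right_span B"
    show "closure_idem A \<otimes> r \<otimes> n = \<zero>"
      by (rule kills_right_span[OF _ _ _ n])
        (use closure_idem_kills[OF A _ _ r] B AB S singular_simplesD(3) e r in auto)
  qed
qed

text \<open>A nonzero \<open>x r e\<^sub>A\<close> makes \<open>xR\<close> a quotient of
  \<open>e\<^sub>A R\<close>, and \<open>x = x r e\<^sub>A t\<close> for some \<open>t\<close>.
  Substituted into \<open>x s e\<^sub>B\<close>, this gives \<open>x\<close> times a singular
  element, which is zero.\<close>

lemma simple_sees_one:
  assumes x: "simple_gen x" and A: "A \<subseteq> simple_reps" and B: "B \<subseteq> simple_reps" and AB: "A \<inter> B = {}"
    and r: "r \<in> carrier R" "x \<otimes> r \<otimes> closure_idem A \<noteq> \<zero>"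
    and s: "s \<in> carrier R" "x \<otimes> s \<otimes> closure_idem B \<noteq> \<zero>"
  shows False
proof -
  have S: "A \<subseteq> singular_simples" "B \<subseteq> singular_simples" using A B simple_reps_singular by auto
  note e = closure_idem(1)[OF S(1)] and f = closure_idem(1)[OF S(2)] and x' = simple_genD[OF x]
  obtain t where t: "t \<in> carrier R" "x \<otimes> (r \<otimes> closure_idem A) \<otimes> t = x"
    using x'(3)[of "r \<otimes> closure_idem A"] x'(1) r e by (auto simp: m_assoc)
  have "closure_idem A \<otimes> (t \<otimes> s) \<otimes> closure_idem B \<in> right_singular"
    using closure_idem_disjoint[OF A B AB] t s by simp
  then have "x \<otimes> (r \<otimes> (closure_idem A \<otimes> (t \<otimes> s) \<otimes> closure_idem B)) = \<zero>"
    using simple_kills_singular[OF x] right_singular_lmult r by blast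
  then have "x \<otimes> (r \<otimes> closure_idem A) \<otimes> t \<otimes> s \<otimes> closure_idem B = \<zero>"
    using x'(1) r(1) e f t(1) s(1) by (simp add: m_assoc)
  then show False using t s by simp
qed

text \<open>If \<open>x\<close> kills \<open>A\<close>, then \<open>x e\<^sub>A\<close> is singular,
  as it kills an essential submodule; otherwise some nonzero \<open>x \<otimes> j\<close> is
  singular. By simplicity \<open>x\<close> is a right multiple of that singular element.\<close>

lemma simple_sees_closure_singular:
  assumes x: "simple_gen x" and A: "A \<subseteq> singular_simples"
    and nz: "x \<otimes> closure_idem A \<noteq> \<zero>"
  shows "x \<in> singular_simples"
proof -
  note e = closure_idem[OF A] and x' = simple_genD[OF x]
  have "x \<in> right_singular"
  proof (cases "\<forall>j\<in>A. x \<otimes> j = \<zero>")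
    case True
    have "x \<otimes> closure_idem A \<in> right_singular"
      by (rule right_singular_if_kills_essential[OF e(3,1) x'(1)], rule kills_right_span[of A])
        (use True A x' singular_simplesD(3) in auto)
    moreover obtain t where "t \<in> carrier R" "x \<otimes> closure_idem A \<otimes> t = x"
      using x'(3)[OF e(1) nz] by blast
    ultimately show ?thesis using right_singular_rmult by metis
  next
    case False
    then obtain j where j: "j \<in> A" "x \<otimes> j \<noteq> \<zero>" by auto
    note jS = singular_simplesD[OF subsetD[OF A j(1)]]
    obtain t where "t \<in> carrier R" "x \<otimes> j \<otimes> t = x"
      using x'(3)[OF jS(3) j(2)] by blast
    then show ?thesis using right_singular_rmult right_singular_lmult[OF jS(2) x'(1)] by metis
  qed
  then show ?thesis using x by (simp add: singular_simples_def)
qed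

lemma simple_sees_closure_rep:
  assumes x: "simple_gen x" and A: "A \<subseteq> singular_simples"
    and nz: "x \<otimes> closure_idem A \<noteq> \<zero>"
  obtains i r where "i \<in> simple_reps" "r \<in> carrier R" "rann {i \<otimes> r} = rann {x}"
proof -
  have xS: "x \<in> singular_simples"
    by (rule simple_sees_closure_singular[OF x A nz])
  from simple_rep(2)[OF this] obtain r where "r \<in> carrier R" "rann {simple_rep x \<otimes> r} = rann {x}"
    by (auto simp: simple_equiv_def)
  then show ?thesis using that xS by (auto simp: simple_reps_def)
qed

text \<open>The sets \<open>H i\<close> below are independent: \<open>\<beta>\<close> identifies \<open>\<Lambda>\<close> with its finite subsets, and the finite
  set \<open>F'\<close> lies in \<open>{F. i \<in> F}\<close> exactly for \<open>i \<in> F'\<close>. The set \<open>Y i\<close> is \<open>H i\<close> or its complement, chosen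
  such that the simple module \<open>i\<close> is no quotient of the closure of \<open>Y i\<close>.\<close>

lemma finite_simple_reps: "finite simple_reps"
proof (rule ccontr)
  assume inf: "infinite simple_reps"
  let ?L = simple_reps
  let ?e = closure_idem
  have LS: "A \<subseteq> singular_simples" if "A \<subseteq> ?L" for A using that simple_reps_singular by auto
  have ec: "?e A \<in> carrier R" if "A \<subseteq> ?L" for A using closure_idem(1)[OF LS[OF that]] .
  obtain \<beta> where \<beta>: "bij_betw \<beta> ?L (Fpow ?L)"
    using eqpoll_Fpow[OF inf] eqpoll_sym by (auto simp: eqpoll_def)
  define H where "H i = {j \<in> ?L. i \<in> \<beta> j}" for i
  have HL: "H i \<subseteq> ?L" for i by (auto simp: H_def)
  define Y where "Y i = (if \<forall>r\<in>carrier R. i \<otimes> r \<otimes> ?e (H i) = \<zero> then H i else ?L - H i)" for i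
  have YL: "Y i \<subseteq> ?L" "?L - Y i \<subseteq> ?L" for i using HL by (auto simp: Y_def)
  \<comment> \<open>By \<open>simple_sees_one\<close>, the module \<open>iR\<close> is a quotient of
    at most one of the closures of \<open>H i\<close> and of its complement.\<close>
  have blind: "i \<otimes> r \<otimes> ?e (Y i) = \<zero>" if i: "i \<in> ?L" and r: "r \<in> carrier R" for i r
  proof (rule ccontr)
    assume nz: "i \<otimes> r \<otimes> ?e (Y i) \<noteq> \<zero>"
    have ig: "simple_gen i" using singular_simplesD(1)[OF simple_reps_singular[OF i]] .
    from nz r have "Y i = ?L - H i" and "\<not> (\<forall>r\<in>carrier R. i \<otimes> r \<otimes> ?e (H i) = \<zero>)"
      by (auto simp: Y_def split: if_splits)
    then obtain s where "s \<in> carrier R" "i \<otimes> s \<otimes> ?e (H i) \<noteq> \<zero>" and Y: "Y i = ?L - H i" by auto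
    then show False
      using simple_sees_one[OF ig HL YL(1) _ _ _ r nz] by auto
  qed
  \<comment> \<open>Finitely many \<open>Y i\<close> have a common element: the \<open>j\<close> for
    which \<open>\<beta> j\<close> consists of exactly those \<open>i\<close> in \<open>F\<close>
    with \<open>Y i = H i\<close>.\<close>
  have fip: "\<exists>j\<in>?L. \<forall>i\<in>F. j \<in> Y i" if F: "finite F" "F \<subseteq> ?L" for F
  proof -
    have "{i \<in> F. Y i = H i} \<in> Fpow ?L" using F by (auto simp: Fpow_def)
    then obtain j where j: "j \<in> ?L" "\<beta> j = {i \<in> F. Y i = H i}"
      using \<beta> by (metis (no_types, lifting) bij_betw_iff_bijections)
    have "j \<in> Y i" if "i \<in> F" for i
      using j that by (cases "Y i = H i") (auto simp: H_def Y_def split: if_splits)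
    then show ?thesis using j by auto
  qed
  \<comment> \<open>A simple \<open>x\<close> killing \<open>G\<close> satisfies
    \<open>x \<otimes> ?e ?L = x\<close> and kills \<open>?e (?L - Y i)\<close> for every
    \<open>i\<close>.\<close>
  define G where "G = insert (\<one> \<ominus> ?e ?L) ((\<lambda>i. ?e (?L - Y i)) ` ?L)"
  have Gc: "G \<subseteq> carrier R" using ec YL by (auto simp: G_def)
  \<comment> \<open>An element of the span involves only finitely many \<open>i\<close>, collected
    in \<open>F\<close>. If \<open>j\<close> lies in all their \<open>Y i\<close>, then
    \<open>{j}\<close> is disjoint from each complement involved, so every term becomes
    singular.\<close>
  have spanG: "\<exists>F. finite F \<and> F \<subseteq> ?L \<and>
      (\<forall>j\<in>?L. (\<forall>i\<in>F. j \<in> Y i) \<longrightarrow> ?e {j} \<otimes> ?e ?L \<otimes> q \<in> right_singular)" if "q \<in> right_span G" for q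
    using that
  proof induction
    case zero
    show ?case
      by (rule exI[of _ "{}"]) (use ec in \<open>auto simp: right_singular_zero\<close>)
  next
    case (step u g a)
    note uc = subsetD[OF right_span_subset[OF Gc] step(1)]
    have gc: "g \<in> carrier R" using step(2) Gc by auto
    obtain F where F: "finite F" "F \<subseteq> ?L"
      "\<And>j. \<lbrakk>j \<in> ?L; \<forall>i\<in>F. j \<in> Y i\<rbrakk> \<Longrightarrow> ?e {j} \<otimes> ?e ?L \<otimes> u \<in> right_singular"
      using step.IH by blast
    have "\<exists>F'. finite F' \<and> F' \<subseteq> ?L \<and>
      (\<forall>j\<in>?L. (\<forall>i\<in>F'. j \<in> Y i) \<longrightarrow> ?e {j} \<otimes> ?e ?L \<otimes> g \<in> right_singular)"
    proof (cases "g = \<one> \<ominus> ?e ?L")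
      case True
      show ?thesis
      proof (rule exI[of _ "{}"], intro conjI ballI impI)
        fix j assume j: "j \<in> ?L"
        have "?e ?L \<otimes> g = \<zero>"
          using True closure_idem(4)[OF LS] ec by (simp add: a_minus_def r_distr r_minus r_neg)
        then have "?e ?L \<otimes> g \<in> right_singular"
          using right_singular_zero by simp
        then show "?e {j} \<otimes> ?e ?L \<otimes> g \<in> right_singular"
          using right_singular_lmult[of "?e ?L \<otimes> g" "?e {j}"] ec j gc by (simp add: m_assoc)
      qed auto
    next
      case False
      then obtain i where i: "i \<in> ?L" "g = ?e (?L - Y i)" using step(2) by (auto simp: G_def)
      have "?e {j} \<otimes> ?e ?L \<otimes> g \<in> right_singular" if "j \<in> ?L" "j \<in> Y i" for j
        using closure_idem_disjoint[of "{j}" "?L - Y i" "?e ?L"] that i ec by auto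
      then show ?thesis using i by (intro exI[of _ "{i}"]) auto
    qed
    then obtain F' where F': "finite F'" "F' \<subseteq> ?L"
      "\<And>j. \<lbrakk>j \<in> ?L; \<forall>i\<in>F'. j \<in> Y i\<rbrakk> \<Longrightarrow> ?e {j} \<otimes> ?e ?L \<otimes> g \<in> right_singular"
      by blast
    show ?case
    proof (intro exI[of _ "F \<union> F'"] conjI ballI impI)
      fix j assume j: "j \<in> ?L" "\<forall>i\<in>F \<union> F'. j \<in> Y i"
      have "?e {j} \<otimes> ?e ?L \<otimes> (u \<oplus> g \<otimes> a) =
          ?e {j} \<otimes> ?e ?L \<otimes> u \<oplus> ?e {j} \<otimes> ?e ?L \<otimes> g \<otimes> a"
        using uc gc step(3) j ec by (simp add: r_distr m_assoc)
      then show "?e {j} \<otimes> ?e ?L \<otimes> (u \<oplus> g \<otimes> a) \<in> right_singular"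
        using F(3) F'(3) j step(3) right_singular_add right_singular_rmult by auto
    qed (use F F' in auto)
  qed
  \<comment> \<open>Otherwise \<open>?e {j} \<otimes> ?e ?L\<close> would be singular for some
    \<open>j\<close>, hence kill \<open>j\<close>; but it fixes \<open>j\<close>.\<close>
  have "\<one> \<notin> right_span G"
  proof
    assume "\<one> \<in> right_span G"
    from spanG[OF this] obtain F where F: "finite F \<and> F \<subseteq> ?L \<and>
      (\<forall>j\<in>?L. (\<forall>i\<in>F. j \<in> Y i) \<longrightarrow> ?e {j} \<otimes> ?e ?L \<otimes> \<one> \<in> right_singular)"
      by (rule exE)
    then obtain j where j: "j \<in> ?L" "\<forall>i\<in>F. j \<in> Y i" using fip by metis
    then have "?e {j} \<otimes> ?e ?L \<otimes> \<one> \<in> right_singular" using F by simp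
    then have "?e {j} \<otimes> ?e ?L \<in> right_singular" using ec j by simp
    moreover note jS = singular_simplesD[OF simple_reps_singular[OF j(1)]]
    ultimately have "?e {j} \<otimes> ?e ?L \<otimes> j = \<zero>"
      using singular_kills_simple by blast
    moreover have "?e {j} \<otimes> (?e ?L \<otimes> j) = j"
      using closure_idem_fix[OF LS] j by simp
    ultimately show False
      using simple_genD(2)[OF jS(1)] ec j jS by (simp add: m_assoc)
  qed
  then obtain x where x: "simple_gen x" "right_span G \<subseteq> rann {x}"
    using simple_gen_containing[OF right_ideal_right_span[OF Gc]] by blast
  note xc = simple_genD[OF x(1)]
  have xG: "x \<otimes> g = \<zero>" if "g \<in> G" for g
    using x(2) right_span_superset[OF Gc] that by (auto simp: rannD)
  have "x \<otimes> (\<one> \<ominus> ?e ?L) = \<zero>" using xG by (simp add: G_def)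
  then have "x \<ominus> x \<otimes> ?e ?L = \<zero>" using xc ec by (simp add: a_minus_def r_distr r_minus)
  then have xe: "x \<otimes> ?e ?L = x" using xc ec by simp
  \<comment> \<open>The diagonal step: \<open>x\<close> is isomorphic to some \<open>i\<close> in
    \<Lambda> and, like \<open>i\<close>, kills the closure idempotent of \<open>Y i\<close>, while
    \<open>G\<close> makes it kill that of the complement.\<close>
  then obtain i r where i: "i \<in> ?L" "r \<in> carrier R" "rann {i \<otimes> r} = rann {x}"
    using simple_sees_closure_rep[OF x(1) LS[OF order.refl]] xc by metis
  have ic: "i \<in> carrier R" using singular_simplesD(3)[OF simple_reps_singular[OF i(1)]] .
  have x1: "x \<otimes> ?e (Y i) = \<zero>"
  proof -
    have "?e (Y i) \<in> rann {i \<otimes> r}"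
      using blind[OF i(1,2)] ec[OF YL(1)] by (simp add: rannD)
    then show ?thesis unfolding i(3) by (simp add: rannD)
  qed
  have x2: "x \<otimes> ?e (?L - Y i) = \<zero>"
    using xG i by (auto simp: G_def)
  \<comment> \<open>\<open>?d\<close> kills every member of \<Lambda>, so
    \<open>?d \<otimes> ?e ?L\<close> is singular and killed by \<open>x\<close>; yet right
    multiplication by either factor fixes \<open>x\<close>.\<close>
  let ?d = "?e ?L \<ominus> (?e (Y i) \<oplus> ?e (?L - Y i))"
  have ecs: "?e ?L \<in> carrier R" "?e (Y i) \<in> carrier R" "?e (?L - Y i) \<in> carrier R"
    using ec YL by auto
  have kill: "?d \<otimes> j = \<zero>" if j: "j \<in> ?L" for j
  proof -
    have jc: "j \<in> carrier R" using singular_simplesD(3)[OF simple_reps_singular[OF j]] .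
    have L: "?e ?L \<otimes> j = j" using closure_idem_fix[OF LS] j by simp
    have K: "?e A \<otimes> j = \<zero>" if "A \<subseteq> ?L" "j \<notin> A" for A
      using closure_idem_kills[OF that(1) j that(2) one_closed] ec[OF that(1)] by simp
    have "?e (Y i) \<otimes> j \<oplus> ?e (?L - Y i) \<otimes> j = j"
    proof (cases "j \<in> Y i")
      case True
      then show ?thesis
        using K[OF YL(2)] closure_idem_fix[OF LS[OF YL(1)] True] jc by simp
    next
      case False
      then show ?thesis
        using K[OF YL(1)] closure_idem_fix[OF LS[OF YL(2)], of j i] jc j by simp
    qed
    then have "?d \<otimes> j = j \<ominus> j"
      using L jc ecs by (simp add: a_minus_def l_distr l_minus)
    then show ?thesis
      using jc by (simp add: a_minus_def r_neg)
  qed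
  have "?d \<otimes> ?e ?L \<in> right_singular"
    by (rule right_singular_if_kills_essential[OF closure_idem(3,1)[OF LS[OF order.refl]]],
        simp add: ecs, rule kills_right_span[of ?L])
      (use kill ecs singular_simplesD(3)[OF simple_reps_singular] in auto)
  then have "x \<otimes> (?d \<otimes> ?e ?L) = \<zero>"
    using simple_kills_singular[OF x(1)] by blast
  then have "x \<otimes> ?d \<otimes> ?e ?L = \<zero>"
    using xc ecs by (simp add: m_assoc)
  moreover have "x \<otimes> ?d = x"
    using x1 x2 xe xc ecs by (simp add: a_minus_def r_distr r_minus)
  ultimately show False using xe xc by simp
qed

end

section \<open>The descending chain condition\<close>

context ring
begin

text \<open>The element \<open>c\<close> generates the simple essential socle of \<open>vR\<close>; \<open>v = \<zero>\<close> is allowed. By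
  \<open>rann W \<subseteq> rann {t}\<close> the module \<open>tR\<close> is a subquotient of the sum of the \<open>wR\<close> with \<open>w \<in> W\<close>.\<close>

definition uniform_gen :: "'a \<Rightarrow> bool" where
  "uniform_gen v \<longleftrightarrow> v \<in> carrier R \<and>
     (\<exists>c\<in>carrier R. c \<noteq> \<zero> \<and> (\<forall>r\<in>carrier R. v \<otimes> r \<noteq> \<zero> \<longrightarrow> (\<exists>s\<in>carrier R. v \<otimes> r \<otimes> s = c)))"

definition uniformly_embedded :: "'a set" where
  "uniformly_embedded =
     {t \<in> carrier R. \<exists>W. finite W \<and> (\<forall>w\<in>W. uniform_gen w) \<and> rann W \<subseteq> rann {t}}"

lemma uniform_genE:
  assumes "uniform_gen v"
  obtains c where "v \<in> carrier R" "c \<in> carrier R" "c \<noteq> \<zero>"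
    "\<And>r. \<lbrakk>r \<in> carrier R; v \<otimes> r \<noteq> \<zero>\<rbrakk> \<Longrightarrow> \<exists>s\<in>carrier R. v \<otimes> r \<otimes> s = c"
  using assms unfolding uniform_gen_def by auto

lemma uniform_gen_rmult:
  assumes v: "uniform_gen v" and b: "b \<in> carrier R"
  shows "uniform_gen (v \<otimes> b)"
proof -
  obtain c where vc: "v \<in> carrier R" and c: "c \<in> carrier R" "c \<noteq> \<zero>"
    "\<And>r. \<lbrakk>r \<in> carrier R; v \<otimes> r \<noteq> \<zero>\<rbrakk> \<Longrightarrow> \<exists>s\<in>carrier R. v \<otimes> r \<otimes> s = c"
    using uniform_genE[OF v] by metis
  have "\<exists>s\<in>carrier R. v \<otimes> b \<otimes> r \<otimes> s = c" if "r \<in> carrier R" "v \<otimes> b \<otimes> r \<noteq> \<zero>" for r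
    using c(3)[of "b \<otimes> r"] that vc b by (simp add: m_assoc)
  then show ?thesis
    using vc b c(1,2) unfolding uniform_gen_def by blast
qed

lemma uniform_gen_carrier: "uniform_gen v \<Longrightarrow> v \<in> carrier R"
  by (simp add: uniform_gen_def)

lemma uniformly_embedded_uniform: "uniform_gen v \<Longrightarrow> v \<in> uniformly_embedded"
  unfolding uniformly_embedded_def uniform_gen_def
  by (auto intro!: exI[of _ "{v}"] simp: uniform_gen_def)

lemma uniformly_embedded_lmult:
  assumes "t \<in> uniformly_embedded" "a \<in> carrier R"
  shows "a \<otimes> t \<in> uniformly_embedded"
proof -
  obtain W where W: "t \<in> carrier R" "finite W" "\<forall>w\<in>W. uniform_gen w" "rann W \<subseteq> rann {t}"
    using assms by (auto simp: uniformly_embedded_def)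
  have "rann {t} \<subseteq> rann {a \<otimes> t}"
    using W(1) assms by (auto simp: rannD m_assoc)
  then show ?thesis
    using W assms unfolding uniformly_embedded_def by blast
qed

text \<open>Sums use the union of the two finite sets. Right multiples use the elements
  \<open>w \<otimes> r\<close>, because \<open>s\<close> annihilates all of them exactly if
  \<open>r \<otimes> s\<close> annihilates \<open>W\<close>.\<close>

lemma right_ideal_uniformly_embedded: "right_ideal uniformly_embedded"
proof -
  have "x \<oplus> y \<in> uniformly_embedded" if xy: "x \<in> uniformly_embedded" "y \<in> uniformly_embedded" for x y
  proof -
    obtain W where W: "x \<in> carrier R" "finite W" "\<forall>w\<in>W. uniform_gen w" "rann W \<subseteq> rann {x}"
      using xy(1) unfolding uniformly_embedded_def by blast
    obtain V where V: "y \<in> carrier R" "finite V" "\<forall>w\<in>V. uniform_gen w" "rann V \<subseteq> rann {y}"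
      using xy(2) unfolding uniformly_embedded_def by blast
    have "r \<in> rann {x \<oplus> y}" if "r \<in> rann (W \<union> V)" for r
    proof -
      have "r \<in> rann {x}" "r \<in> rann {y}" using that W(4) V(4) by (auto simp: rann_def)
      then show ?thesis using W(1) V(1) by (simp add: rannD l_distr)
    qed
    then have "rann (W \<union> V) \<subseteq> rann {x \<oplus> y}" by blast
    then show ?thesis
      using W V unfolding uniformly_embedded_def by (intro CollectI conjI exI[of _ "W \<union> V"]) auto
  qed
  moreover have "x \<otimes> r \<in> uniformly_embedded" if x: "x \<in> uniformly_embedded" and r: "r \<in> carrier R" for x r
  proof -
    obtain W where W: "x \<in> carrier R" "finite W" "\<forall>w\<in>W. uniform_gen w" "rann W \<subseteq> rann {x}"
      using x by (auto simp: uniformly_embedded_def)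
    have "s \<in> rann {x \<otimes> r}" if s: "s \<in> rann ((\<lambda>w. w \<otimes> r) ` W)" for s
    proof -
      have sc: "s \<in> carrier R" using s by (simp add: rann_def)
      have "w \<otimes> (r \<otimes> s) = \<zero>" if "w \<in> W" for w
        using s that uniform_gen_carrier[OF bspec[OF W(3) that]] r by (auto simp: rann_def m_assoc)
      then have "r \<otimes> s \<in> rann W" using r sc by (simp add: rann_def)
      then show ?thesis using W(1,4) r sc by (auto simp: rannD m_assoc)
    qed
    then have "rann ((\<lambda>w. w \<otimes> r) ` W) \<subseteq> rann {x \<otimes> r}" by blast
    then show ?thesis
      using W r uniform_gen_rmult unfolding uniformly_embedded_def
      by (intro CollectI conjI exI[of _ "(\<lambda>w. w \<otimes> r) ` W"]) auto
  qed
  moreover have "\<zero> \<in> uniformly_embedded"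
    unfolding uniformly_embedded_def by (auto simp: rann_def)
  ultimately show ?thesis
    by (auto simp: right_ideal_def uniformly_embedded_def)
qed

text \<open>The proof drops the elements of \<open>W\<close> one at a time: if \<open>v (K n \<inter> rann U)\<close> were nonzero for all \<open>n\<close>,
  then \<open>c\<close> would have a preimage in each \<open>K n\<close>, and these preimages agree modulo \<open>rann W\<close>.\<close>

lemma descending_chain_stabilizes:
  assumes K: "\<And>n. right_ideal (K n)" "\<And>n. K (Suc n) \<subseteq> K n" and int: "(\<Inter>n. K n) = rann W"
    and W: "finite W" "\<And>w. w \<in> W \<Longrightarrow> uniform_gen w"
  shows "\<exists>n. \<forall>m\<ge>n. K m = K n"
proof -
  have dec: "K m \<subseteq> K n" if "n \<le> m" for n m
    using lift_Suc_antimono_le[of K] K(2) that by blast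
  have Wc: "W \<subseteq> carrier R" using W(2) uniform_gen_carrier by auto
  \<comment> \<open>\<open>V\<close> holds the dropped elements. At \<open>V = W\<close> the set
    \<open>rann (W - V)\<close> is all of \<open>carrier R\<close>, so \<open>K n\<close> lies in
    the intersection of the chain.\<close>
  have "finite V \<Longrightarrow> V \<subseteq> W \<Longrightarrow> \<exists>n. K n \<inter> rann (W - V) \<subseteq> rann W" for V
  proof (induction V rule: finite_induct)
    case empty
    then show ?case by auto
  next
    case (insert v V)
    then obtain N where N: "K N \<inter> rann (W - V) \<subseteq> rann W" by auto
    let ?U = "W - insert v V"
    have vW: "v \<in> W" using insert.prems by auto
    obtain c where v: "v \<in> carrier R" and c: "c \<in> carrier R" "c \<noteq> \<zero>"
      "\<And>r. \<lbrakk>r \<in> carrier R; v \<otimes> r \<noteq> \<zero>\<rbrakk> \<Longrightarrow> \<exists>s\<in>carrier R. v \<otimes> r \<otimes> s = c"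
      using uniform_genE[OF W(2)[OF vW]] by metis
    have U: "right_ideal (rann ?U)" using Wc by (intro right_ideal_rann) auto
    have split: "r \<in> rann (W - V)" if "r \<in> rann ?U" "v \<otimes> r = \<zero>" for r
      using that by (auto simp: rann_def)
    show ?case
    proof (rule ccontr)
      assume contr: "\<nexists>n. K n \<inter> rann ?U \<subseteq> rann W"
      have "\<exists>x. x \<in> K n \<inter> rann ?U \<and> v \<otimes> x = c" if n: "n \<ge> N" for n
      proof -
        obtain x where x: "x \<in> K n" "x \<in> rann ?U" "x \<notin> rann W" using contr by blast
        then have xc: "x \<in> carrier R" by (simp add: rann_def)
        \<comment> \<open>If \<open>v\<close> killed \<open>x\<close>, then \<open>x\<close> would
          lie in \<open>K N \<inter> rann (W - V)\<close>, hence in \<open>rann W\<close>.\<close>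
        have "v \<otimes> x \<noteq> \<zero>"
          using split[OF x(2)] x dec[OF n] N by blast
        then obtain s where s: "s \<in> carrier R" "v \<otimes> x \<otimes> s = c" using c(3)[OF xc] by blast
        then have "x \<otimes> s \<in> K n \<inter> rann ?U" "v \<otimes> (x \<otimes> s) = c"
          using right_idealD(4)[OF K(1) x(1)] right_idealD(4)[OF U x(2)] xc v by (auto simp: m_assoc)
        then show ?thesis by blast
      qed
      then obtain x where x: "\<And>n. n \<ge> N \<Longrightarrow> x n \<in> K n \<and> x n \<in> rann ?U \<and> v \<otimes> x n = c"
        by (metis IntD1 IntD2)
      have xN: "x N \<in> K n" for n
      proof -
        \<comment> \<open>The maximum keeps the index at least \<open>N\<close>, where a preimage of
          \<open>c\<close> was chosen. The two preimages differ by an element of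
          \<open>K N \<inter> rann (W - V)\<close>, hence of every member of the chain.\<close>
        let ?n = "max n N"
        have xs: "x N \<in> K N" "x N \<in> rann ?U" "v \<otimes> x N = c"
          "x ?n \<in> K ?n" "x ?n \<in> rann ?U" "v \<otimes> x ?n = c"
          using x[of N] x[of ?n] by auto
        then have xcs: "x N \<in> carrier R" "x ?n \<in> carrier R" by (auto simp: rann_def)
        have "x N \<ominus> x ?n \<in> K N"
          using right_idealD(6)[OF K(1)] xs dec[of N ?n] by auto
        moreover have "x N \<ominus> x ?n \<in> rann (W - V)"
        proof (rule split)
          show "x N \<ominus> x ?n \<in> rann ?U" using right_idealD(6)[OF U] xs by blast
          show "v \<otimes> (x N \<ominus> x ?n) = \<zero>"
            using xs(3,6) xcs v c(1) by (simp add: a_minus_def r_distr r_minus r_neg)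
        qed
        ultimately have "x N \<ominus> x ?n \<in> rann W" using N by blast
        then have "x N \<ominus> x ?n \<in> K ?n" using int by blast
        then have "(x N \<ominus> x ?n) \<oplus> x ?n \<in> K ?n"
          using right_idealD(3)[OF K(1)] xs by blast
        then have "x N \<in> K ?n" using xcs by (simp add: a_minus_def a_assoc l_neg)
        then show ?thesis using dec[of n ?n] by auto
      qed
      then have "x N \<in> rann W" using int by blast
      then show False using x[of N] vW c(2) by (simp add: rann_def)
    qed
  qed
  from this[OF W(1) order.refl] obtain n where "K n \<inter> rann {} \<subseteq> rann W" by auto
  moreover have "K n \<subseteq> rann {}" using right_idealD(1)[OF K(1)] by (auto simp: rann_def)
  ultimately have "K n \<subseteq> K m" for m using int by blast
  then show ?thesis using dec by blast
qed

end

section \<open>The identity lies in the trace ideal\<close>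

context cf_gc2_ring
begin

text \<open>The socle generator is \<open>j\<close>: every nonzero element of
  \<open>e\<^sub>j R\<close> has a nonzero multiple in \<open>jR\<close>, from which simplicity
  recovers \<open>j\<close>.\<close>

lemma closure_idem_uniform:
  assumes j: "j \<in> singular_simples"
  shows "uniform_gen (closure_idem {j})"
proof -
  have A: "{j} \<subseteq> singular_simples" using j by simp
  note e = closure_idem[OF A] and jS = singular_simplesD[OF j]
  have span: "\<exists>a\<in>carrier R. n = j \<otimes> a" if "n \<in> right_span {j}" for n
    using that
  proof induction
    case zero
    show ?case by (rule bexI[of _ \<zero>]) (use jS in auto)
  next
    case (step u x a)
    then obtain b where "b \<in> carrier R" "u = j \<otimes> b" by auto
    then show ?case
      using step jS by (intro bexI[of _ "b \<oplus> a"]) (auto simp: r_distr)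
  qed
  have "\<exists>s\<in>carrier R. closure_idem {j} \<otimes> r \<otimes> s = j"
    if r: "r \<in> carrier R" "closure_idem {j} \<otimes> r \<noteq> \<zero>" for r
  proof -
    obtain s where s: "s \<in> carrier R" "closure_idem {j} \<otimes> r \<otimes> s \<in> right_span {j}"
      "closure_idem {j} \<otimes> r \<otimes> s \<noteq> \<zero>"
      using e(3) r unfolding ess_in_def by blast
    then obtain a where a: "a \<in> carrier R" "closure_idem {j} \<otimes> r \<otimes> s = j \<otimes> a"
      using span by blast
    then obtain t where t: "t \<in> carrier R" "j \<otimes> a \<otimes> t = j"
      using simple_genD(3)[OF jS(1)] s by metis
    have "closure_idem {j} \<otimes> r \<otimes> (s \<otimes> t) = closure_idem {j} \<otimes> r \<otimes> s \<otimes> t"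
      using t(1) s(1) r(1) e(1) by (simp add: m_assoc)
    then show ?thesis
      using a t s(1) by (intro bexI[of _ "s \<otimes> t"]) auto
  qed
  then show ?thesis
    unfolding uniform_gen_def using e(1) jS simple_genD(2)[OF jS(1)] by blast
qed

text \<open>Each \<open>e\<^sub>j R\<close> has a simple quotient, represented by some
  \<open>\<tau> j\<close> in \<Lambda>. By \<open>simple_sees_one\<close> the map \<tau> is
  injective, and finiteness of \<Lambda> makes it surjective.\<close>

lemma simple_rep_seen:
  assumes i: "i \<in> simple_reps"
  shows "\<exists>j\<in>simple_reps. \<exists>r\<in>carrier R. i \<otimes> r \<otimes> closure_idem {j} \<noteq> \<zero>"
proof -
  define sees where "sees y j \<longleftrightarrow> (\<exists>r\<in>carrier R. y \<otimes> r \<otimes> closure_idem {j} \<noteq> \<zero>)" for y j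
  have "\<exists>y\<in>simple_reps. sees y j" if j: "j \<in> simple_reps" for j
  proof -
    have A: "{j} \<subseteq> singular_simples" using j simple_reps_singular by simp
    note e = closure_idem[OF A] and jS = singular_simplesD[OF simple_reps_singular[OF j]]
    let ?e = "closure_idem {j}"
    have nz: "?e \<noteq> \<zero>"
      using closure_idem_fix[OF A, of j] simple_genD(2)[OF jS(1)] jS by auto
    have kill: "?e \<otimes> (\<one> \<ominus> ?e) = \<zero>"
      using e(1,4) by (simp add: a_minus_def r_distr r_minus r_neg)
    \<comment> \<open>A simple \<open>x\<close> whose annihilator contains \<open>rann {?e}\<close>
      gives a quotient of \<open>?e R\<close>. It kills \<open>\<one> \<ominus> ?e\<close>, so
      \<open>x \<otimes> ?e = x\<close>.\<close>
    have Q: "right_ideal (rann {?e})"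
      by (rule right_ideal_rann) (use e in auto)
    moreover have "\<one> \<notin> rann {?e}" using nz e by (simp add: rannD)
    ultimately obtain x where x: "simple_gen x" "rann {?e} \<subseteq> rann {x}"
      using simple_gen_containing by blast
    have xc: "x \<in> carrier R" "x \<noteq> \<zero>" using simple_genD[OF x(1)] by auto
    have "\<one> \<ominus> ?e \<in> rann {?e}" using kill e(1) by (simp add: rannD)
    then have "\<one> \<ominus> ?e \<in> rann {x}" using x(2) by blast
    then have "x \<ominus> x \<otimes> ?e = \<zero>"
      using xc e(1) by (simp add: rannD a_minus_def r_distr r_minus)
    then have xe: "x \<otimes> ?e = x" using xc e by simp
    then obtain y r where y: "y \<in> simple_reps" "r \<in> carrier R" "rann {y \<otimes> r} = rann {x}"
      using simple_sees_closure_rep[OF x(1) A] xc by metis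
    have "?e \<notin> rann {y \<otimes> r}" unfolding y(3) using xe xc by (simp add: rannD)
    then have "sees y j" using y(2) e by (auto simp: sees_def rannD)
    then show ?thesis using y by auto
  qed
  then obtain \<tau> where \<tau>: "\<And>j. j \<in> simple_reps \<Longrightarrow> \<tau> j \<in> simple_reps \<and> sees (\<tau> j) j"
    by metis
  have "inj_on \<tau> simple_reps"
  proof (rule inj_onI, rule ccontr)
    fix j k assume jk: "j \<in> simple_reps" "k \<in> simple_reps" "\<tau> j = \<tau> k" "j \<noteq> k"
    then have "sees (\<tau> j) j" "sees (\<tau> j) k" using \<tau> by metis+
    moreover have "simple_gen (\<tau> j)"
      using singular_simplesD(1) simple_reps_singular \<tau> jk by blast
    ultimately show False
      using simple_sees_one[of "\<tau> j" "{j}" "{k}"] jk unfolding sees_def by auto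
  qed
  moreover have "\<tau> ` simple_reps \<subseteq> simple_reps" using \<tau> by auto
  ultimately have "\<tau> ` simple_reps = simple_reps"
    using endo_inj_surj[OF finite_simple_reps] by blast
  then obtain j where "j \<in> simple_reps" "i = \<tau> j" using i by blast
  then show ?thesis using \<tau>[of j] by (auto simp: sees_def)
qed

text \<open>Otherwise a simple \<open>x\<close> kills the whole ideal. If \<open>x\<close> is
  singular, it fails to kill a left multiple of some \<open>e\<^sub>j\<close>; if not, it fails to
  kill the generator of a copy of \<open>xR\<close>. Both elements belong to the ideal.\<close>

lemma one_uniformly_embedded: "\<one> \<in> uniformly_embedded"
proof (rule ccontr)
  assume "\<one> \<notin> uniformly_embedded"
  then obtain x where x: "simple_gen x" "uniformly_embedded \<subseteq> rann {x}"
    using simple_gen_containing[OF right_ideal_uniformly_embedded] by blast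
  note x' = simple_genD[OF x(1)]
  have kill: "x \<otimes> t = \<zero>" if "t \<in> uniformly_embedded" for t
    using x(2) that by (auto simp: rannD)
  show False
  proof (cases "x \<in> right_singular")
    case True
    then have xS: "x \<in> singular_simples" using x by (simp add: singular_simples_def)
    define i where "i = simple_rep x"
    have i: "i \<in> simple_reps" "simple_equiv x i" "simple_gen i"
      using simple_rep[OF xS] xS singular_simplesD(1) by (auto simp: i_def simple_reps_def)
    then obtain s where s: "s \<in> carrier R" "rann {x \<otimes> s} = rann {i}"
      using simple_equiv_sym[OF x(1)] unfolding simple_equiv_def by blast
    obtain j r where j: "j \<in> simple_reps" "r \<in> carrier R" "i \<otimes> r \<otimes> closure_idem {j} \<noteq> \<zero>"
      using simple_rep_seen[OF i(1)] by blast
    have jS: "j \<in> singular_simples" using simple_reps_singular j by blast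
    let ?e = "closure_idem {j}"
    have e: "?e \<in> carrier R" using closure_idem(1) jS by simp
    have "r \<otimes> ?e \<notin> rann {i}"
      using j e simple_genD(1)[OF i(3)] by (simp add: rannD m_assoc)
    then have "x \<otimes> s \<otimes> (r \<otimes> ?e) \<noteq> \<zero>"
      unfolding s(2)[symmetric] using j e by (simp add: rannD)
    then have "x \<otimes> (s \<otimes> (r \<otimes> ?e)) \<noteq> \<zero>"
      using x' s j e by (simp add: m_assoc)
    then show False
      using kill uniformly_embedded_lmult uniformly_embedded_uniform[OF closure_idem_uniform[OF jS]] s j
      by blast
  next
    case False
    \<comment> \<open>As \<open>x\<close> is not singular, left multiplication by \<open>x\<close>
      is injective on some nonzero \<open>aR\<close>. Rescaling \<open>a\<close> to \<open>g\<close>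
      with \<open>x \<otimes> g = x\<close> makes \<open>gR\<close> a copy of \<open>xR\<close>,
      uniform with socle generator \<open>g\<close> itself.\<close>
    then obtain a where a: "a \<in> carrier R" "x \<otimes> a \<noteq> \<zero>"
      and no: "\<And>r. \<lbrakk>r \<in> carrier R; x \<otimes> (a \<otimes> r) = \<zero>\<rbrakk> \<Longrightarrow> a \<otimes> r = \<zero>"
      using right_singularI[OF x'(1)] by blast
    then obtain t where t: "t \<in> carrier R" "x \<otimes> a \<otimes> t = x" using x'(3) by blast
    define g where "g = a \<otimes> t"
    have g: "g \<in> carrier R" "x \<otimes> g = x" using a t x' by (auto simp: g_def m_assoc)
    have nog: "g \<otimes> r = \<zero>" if "r \<in> carrier R" "x \<otimes> (g \<otimes> r) = \<zero>" for r
      using no[of "t \<otimes> r"] that a t x' by (simp add: g_def m_assoc)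
    have "\<exists>s\<in>carrier R. g \<otimes> r \<otimes> s = g" if r: "r \<in> carrier R" "g \<otimes> r \<noteq> \<zero>" for r
    proof -
      have "x \<otimes> (g \<otimes> r) \<noteq> \<zero>" using r nog by blast
      then obtain s where s: "s \<in> carrier R" "x \<otimes> (g \<otimes> r) \<otimes> s = x"
        using x'(3)[of "g \<otimes> r"] g r by auto
      have "x \<otimes> (g \<otimes> (\<one> \<ominus> r \<otimes> s)) = x \<ominus> x \<otimes> (g \<otimes> r) \<otimes> s"
        using x'(1) g r(1) s(1) by (simp add: a_minus_def r_distr r_minus m_assoc)
      also have "\<dots> = \<zero>" using s x' by (simp add: a_minus_def r_neg)
      finally have "g \<otimes> (\<one> \<ominus> r \<otimes> s) = \<zero>" using nog r s by simp
      then have "g \<ominus> g \<otimes> r \<otimes> s = \<zero>"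
        using g r s by (simp add: a_minus_def r_distr r_minus m_assoc)
      then show "\<exists>s\<in>carrier R. g \<otimes> r \<otimes> s = g"
        using s g r by (intro bexI[of _ s]) auto
    qed
    moreover have "g \<noteq> \<zero>" using g x' by auto
    ultimately have "uniform_gen g"
      using g unfolding uniform_gen_def by blast
    then show False
      using kill[OF uniformly_embedded_uniform] g x' by simp
  qed
qed

theorem right_ideal_dcc:
  assumes K: "\<And>n. right_ideal (K n)" "\<And>n. K (Suc n) \<subseteq> K n"
  shows "\<exists>n. \<forall>m\<ge>n. K m = K n"
proof -
  obtain W where W: "finite W" "\<forall>w\<in>W. uniform_gen w" "rann W \<subseteq> rann {\<one>}"
    using one_uniformly_embedded by (auto simp: uniformly_embedded_def)
  have "right_ideal (\<Inter>n. K n)"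
    unfolding right_ideal_def
  proof (intro conjI ballI INT_I)
    show "(\<Inter>n. K n) \<subseteq> carrier R" using right_idealD(1)[OF K(1)[of 0]] by blast
  next
    fix x y n assume "x \<in> (\<Inter>n. K n)" "y \<in> (\<Inter>n. K n)"
    then show "x \<oplus> y \<in> K n" by (intro right_idealD(3)[OF K(1)]) auto
  next
    fix x r n assume "x \<in> (\<Inter>n. K n)" "r \<in> carrier R"
    then show "x \<otimes> r \<in> K n" by (intro right_idealD(4)[OF K(1)]) auto
  qed (use right_idealD(2)[OF K(1)] in auto)
  from right_annihilator[OF this] obtain F
    where "finite F \<and> F \<subseteq> carrier R \<and> (\<Inter>n. K n) = rann F"
    by (rule exE)
  then have F: "finite F" "F \<subseteq> carrier R" "(\<Inter>n. K n) = rann F"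
    by simp_all
  \<comment> \<open>Modulo the intersection, R embeds in a finite power of R via \<open>F\<close>,
    and each copy is separated by \<open>W\<close>. The products compose the two: if all
    \<open>w \<otimes> x\<close> kill \<open>r\<close>, then \<open>x \<otimes> r\<close> lies in
    \<open>rann W\<close>, hence in \<open>rann {\<one>}\<close>, which is zero.\<close>
  define V where "V = (\<lambda>(w, x). w \<otimes> x) ` (W \<times> F)"
  have Wc: "w \<in> carrier R" if "w \<in> W" for w using W that uniform_gen_carrier by blast
  have "r \<in> rann V \<longleftrightarrow> r \<in> rann F" if r: "r \<in> carrier R" for r
  proof
    assume "r \<in> rann F"
    then show "r \<in> rann V" using Wc F by (auto simp: V_def rann_def m_assoc)
  next
    assume rV: "r \<in> rann V"
    have "x \<otimes> r = \<zero>" if x: "x \<in> F" for x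
    proof -
      have xc: "x \<in> carrier R" using x F by auto
      have "w \<otimes> (x \<otimes> r) = \<zero>" if w: "w \<in> W" for w
      proof -
        have "w \<otimes> x \<in> V" using w x by (auto simp: V_def)
        then have "w \<otimes> x \<otimes> r = \<zero>" using rV by (simp add: rann_def)
        then show ?thesis using Wc[OF w] xc r by (simp add: m_assoc)
      qed
      then have "x \<otimes> r \<in> rann W" using xc r by (simp add: rann_def)
      then have "x \<otimes> r \<in> rann {\<one>}" using W by blast
      then show ?thesis using xc r by (simp add: rannD)
    qed
    then show "r \<in> rann F" using r by (simp add: rann_def)
  qed
  then have "rann V = rann F" by (auto simp: rann_def)
  then have "(\<Inter>n. K n) = rann V" using F by simp
  then show ?thesis
    by (rule descending_chain_stabilizes[of K V, OF K])
      (use W F uniform_gen_rmult in \<open>auto simp: V_def subset_iff\<close>)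
qed

end

section \<open>The regular right module\<close>

context ring
begin

lemma regular_simps [simp]:
  "carrier (regular_right_module R) = carrier R"
  "\<zero>\<^bsub>regular_right_module R\<^esub> = \<zero>"
  "x \<oplus>\<^bsub>regular_right_module R\<^esub> y = x \<oplus> y"
  "r \<odot>\<^bsub>regular_right_module R\<^esub> x = x \<otimes> r"
  by (simp_all add: regular_right_module_def)

lemma a_inv_regular:
  assumes "x \<in> carrier R"
  shows "\<ominus>\<^bsub>regular_right_module R\<^esub> x = \<ominus> x"
proof -
  interpret M: right_module R "regular_right_module R" by (rule regular_right_module)
  show ?thesis
    using M.M.minus_equality[of "\<ominus> x" x] assms by (simp add: l_neg)
qed

lemma submodule_regular_iff: "submodule I R (regular_right_module R) \<longleftrightarrow> right_ideal I"
proof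
  assume "submodule I R (regular_right_module R)"
  then interpret submodule I R "regular_right_module R" .
  show "right_ideal I"
    using subset one_closed m_closed smult_closed by (auto simp: right_ideal_def)
next
  assume I: "right_ideal I"
  interpret M: right_module R "regular_right_module R" by (rule regular_right_module)
  note I' = right_idealD[OF I]
  have "inv\<^bsub>add_monoid (regular_right_module R)\<^esub> x \<in> I" if "x \<in> I" for x
    using a_inv_regular[of x] I'(1,5) that by (auto simp: a_inv_def)
  then show "submodule I R (regular_right_module R)"
    using I' by (intro submodule.intro subgroup.intro submodule_axioms.intro) auto
qed

lemma right_ideal_principal: "x \<in> carrier R \<Longrightarrow> right_ideal {x \<otimes> r | r. r \<in> carrier R}"
proof -
  assume x: "x \<in> carrier R"
  have Z: "right_ideal {\<zero>}" by (auto simp: right_ideal_def)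
  have "{m \<oplus> x \<otimes> t | m t. m \<in> {\<zero>} \<and> t \<in> carrier R} = {x \<otimes> r | r. r \<in> carrier R}"
    using x by force
  then show ?thesis using right_ideal_sum_principal[OF Z x] by simp
qed

text \<open>Every nonzero right ideal contains a nonzero principal one, so testing those
  suffices.\<close>

lemma essential_in_regular_iff:
  "essential_in R (regular_right_module R) N K \<longleftrightarrow>
     right_ideal N \<and> right_ideal K \<and> N \<subseteq> K \<and> ess_in N K"
proof (intro iffI conjI)
  assume E: "essential_in R (regular_right_module R) N K"
  then show K: "right_ideal K" and "right_ideal N" "N \<subseteq> K"
    by (auto simp: essential_in_def submodule_regular_iff)
  show "ess_in N K"
    unfolding ess_in_def
  proof (intro ballI impI)
    fix a assume a: "a \<in> K" "a \<noteq> \<zero>"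
    then have ac: "a \<in> carrier R" using right_idealD(1)[OF K] by blast
    let ?L = "{a \<otimes> r | r. r \<in> carrier R}"
    have aL: "a \<otimes> \<one> \<in> ?L" by blast
    have "?L \<subseteq> K" using right_idealD(4)[OF K a(1)] by blast
    moreover have "?L \<noteq> {\<zero>}" using aL a ac by auto
    ultimately have "N \<inter> ?L \<noteq> {\<zero>}"
      using E right_ideal_principal[OF ac] by (auto simp: essential_in_def submodule_regular_iff)
    moreover have "\<zero> \<in> ?L" by (rule right_idealD(2)[OF right_ideal_principal[OF ac]])
    moreover have "\<zero> \<in> N"
      using E right_idealD(2) by (simp add: essential_in_def submodule_regular_iff)
    ultimately show "\<exists>r\<in>carrier R. a \<otimes> r \<in> N \<and> a \<otimes> r \<noteq> \<zero>" by blast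
  qed
next
  assume *: "right_ideal N \<and> right_ideal K \<and> N \<subseteq> K \<and> ess_in N K"
  have "N \<inter> L \<noteq> {\<zero>}" if L: "right_ideal L" "L \<subseteq> K" "L \<noteq> {\<zero>}" for L
  proof -
    obtain a where a: "a \<in> L" "a \<noteq> \<zero>" using L right_idealD(2)[OF L(1)] by blast
    then obtain r where "r \<in> carrier R" "a \<otimes> r \<in> N" "a \<otimes> r \<noteq> \<zero>"
      using * L(2) unfolding ess_in_def by blast
    then show ?thesis using right_idealD(4)[OF L(1) a(1)] by blast
  qed
  then show "essential_in R (regular_right_module R) N K"
    using * by (auto simp: essential_in_def submodule_regular_iff)
qed

lemma right_annihilator_regular:
  "right_annihilator R (regular_right_module R) x = rann {x}"
  by (auto simp: right_annihilator_def rann_def)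

lemma singular_submodule_regularI:
  assumes "right_ideal N" "N \<subseteq> right_singular"
  shows "singular_submodule R (regular_right_module R) N"
proof -
  have "right_ideal (rann {x})" if "x \<in> N" for x
    using that assms right_singular_carrier by (intro right_ideal_rann) auto
  moreover have "right_ideal (carrier R)" by (auto simp: right_ideal_def)
  ultimately show ?thesis
    using assms by (auto simp: singular_submodule_def submodule_regular_iff essential_in_regular_iff
        right_annihilator_regular right_singular_def rann_def)
qed

lemma simple_submodule_principal:
  assumes x: "simple_gen x"
  shows "simple_submodule R (regular_right_module R) {x \<otimes> r | r. r \<in> carrier R}"
proof -
  note x' = simple_genD[OF x]
  let ?S = "{x \<otimes> r | r. r \<in> carrier R}"
  have "L = ?S" if L: "right_ideal L" "L \<subseteq> ?S" "L \<noteq> {\<zero>}" for L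
  proof -
    obtain a where a: "a \<in> L" "a \<noteq> \<zero>" using L right_idealD(2)[OF L(1)] by blast
    then obtain w where w: "w \<in> carrier R" "a = x \<otimes> w" using L by blast
    then obtain t where "t \<in> carrier R" "a \<otimes> t = x" using x'(3) a by blast
    then have "x \<in> L" using right_idealD(4)[OF L(1) a(1)] by metis
    then show ?thesis using right_idealD(4)[OF L(1)] L(2) by blast
  qed
  moreover have "x \<otimes> \<one> \<in> ?S" by blast
  ultimately show ?thesis
    using right_ideal_principal[OF x'(1)] x'
    by (auto simp: simple_submodule_def submodule_regular_iff)
qed

text \<open>A right ideal containing all simple submodules of the span contains each
  \<open>xR\<close>, hence all generators.\<close>

lemma semisimple_submodule_right_span:
  assumes A: "\<And>x. x \<in> A \<Longrightarrow> simple_gen x"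
  shows "semisimple_submodule R (regular_right_module R) (right_span A)"
proof -
  have Ac: "A \<subseteq> carrier R" using A simple_genD(1) by blast
  note N = right_ideal_right_span[OF Ac]
  have "right_span A \<subseteq> L"
    if L: "right_ideal L" "\<And>S. \<lbrakk>simple_submodule R (regular_right_module R) S; S \<subseteq> right_span A\<rbrakk> \<Longrightarrow> S \<subseteq> L" for L
  proof (rule right_span_least[OF L(1)], rule subsetI)
    fix x assume x: "x \<in> A"
    then have "x \<in> right_span A" using right_span_superset[OF Ac] by blast
    then have "{x \<otimes> r | r. r \<in> carrier R} \<subseteq> right_span A"
      using right_idealD(4)[OF N] by blast
    then have "{x \<otimes> r | r. r \<in> carrier R} \<subseteq> L"
      using L(2) simple_submodule_principal[OF A[OF x]] by blast
    then have "x \<otimes> \<one> \<in> L" by blast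
    then show "x \<in> L" using x Ac by auto
  qed
  then show ?thesis
    using N by (fastforce simp: semisimple_submodule_def submodule_regular_iff)
qed

text \<open>Split \<open>\<one> = e \<oplus> d\<close> along the decomposition. For \<open>x\<close>
  in \<open>D\<close> the element \<open>d \<otimes> x = x \<ominus> e \<otimes> x\<close> lies in
  both summands, so it vanishes.\<close>

lemma direct_summand_idempotent:
  assumes "direct_summand R (regular_right_module R) D"
  shows "\<exists>e\<in>D. \<forall>x\<in>D. e \<otimes> x = x"
proof -
  obtain D' where D: "right_ideal D" "right_ideal D'" "D \<inter> D' = {\<zero>}"
    and sum: "D <+>\<^bsub>regular_right_module R\<^esub> D' = carrier R"
    using assms by (auto simp: direct_summand_def submodule_regular_iff)
  note Dc = right_idealD[OF D(1)] and Dc' = right_idealD[OF D(2)]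
  have "\<one> \<in> D <+>\<^bsub>regular_right_module R\<^esub> D'" using sum by simp
  then obtain e d where ed: "e \<in> D" "d \<in> D'" "\<one> = e \<oplus> d"
    unfolding set_add_def' by auto
  have "e \<otimes> x = x" if x: "x \<in> D" for x
  proof -
    have c: "x \<in> carrier R" "e \<in> carrier R" "d \<in> carrier R" using x ed Dc(1) Dc'(1) by auto
    have "x = (e \<oplus> d) \<otimes> x" using c by (simp flip: ed(3))
    then have eq: "x = e \<otimes> x \<oplus> d \<otimes> x" using c by (simp add: l_distr)
    have "d \<otimes> x = (e \<otimes> x \<oplus> d \<otimes> x) \<ominus> e \<otimes> x"
      using c by (simp add: a_minus_def a_ac r_neg r_neg1 r_neg2)
    then have "d \<otimes> x = x \<ominus> e \<otimes> x" using eq by simp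
    moreover have "e \<otimes> x \<in> D" using Dc(4) ed c by blast
    ultimately have "d \<otimes> x \<in> D" using Dc(6) x by metis
    moreover have "d \<otimes> x \<in> D'" using Dc'(4) ed c by blast
    ultimately have "d \<otimes> x = \<zero>" using D(3) by blast
    then show ?thesis using eq c by simp
  qed
  then show ?thesis using ed by blast
qed

text \<open>Left multiplication by \<open>a\<close> is injective, so \<open>aR\<close> is isomorphic
  to R, hence a summand with a left identity \<open>a \<otimes> b\<close>. Cancelling
  \<open>a\<close> in \<open>a \<otimes> b \<otimes> a = a\<close> gives the claim.\<close>

lemma GC2_left_inverse:
  assumes GC2: "right_GC2_ring R" and a: "a \<in> carrier R" "rann {a} = {\<zero>}"
  shows "\<exists>b\<in>carrier R. b \<otimes> a = \<one>"
proof -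
  let ?M = "regular_right_module R" and ?N = "{a \<otimes> r | r. r \<in> carrier R}"
  have inj: "x = y" if "x \<in> carrier R" "y \<in> carrier R" "a \<otimes> x = a \<otimes> y" for x y
  proof -
    have "a \<otimes> (x \<ominus> y) = \<zero>" using that a by (simp add: a_minus_def r_distr r_minus r_neg)
    then have "x \<ominus> y \<in> rann {a}" using that by (simp add: rannD)
    then show ?thesis using a that by simp
  qed
  have "(\<lambda>x. a \<otimes> x) \<in> right_module_hom R ?M (?M\<lparr>carrier := ?N\<rparr>)"
    using a by (auto simp: right_module_hom_def regular_right_module_def r_distr m_assoc)
  moreover have "bij_betw (\<lambda>x. a \<otimes> x) (carrier ?M) (carrier (?M\<lparr>carrier := ?N\<rparr>))"
    unfolding bij_betw_def using inj by (auto simp: inj_on_def)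
  ultimately have "right_module_iso R ?M (?M\<lparr>carrier := ?N\<rparr>)"
    unfolding right_module_iso_def by blast
  then have "direct_summand R ?M ?N"
    using GC2 right_ideal_principal[OF a(1)]
    by (auto simp: right_GC2_ring_def GC2_module_def submodule_regular_iff)
  then obtain e where e: "e \<in> ?N" "\<forall>x\<in>?N. e \<otimes> x = x"
    using direct_summand_idempotent by blast
  then obtain b where b: "b \<in> carrier R" "e = a \<otimes> b" by blast
  have "a \<otimes> \<one> \<in> ?N" by blast
  then have "a \<otimes> b \<otimes> a = a" using e b a by auto
  then have "a \<otimes> (b \<otimes> a) = a \<otimes> \<one>" using a b by (simp add: m_assoc)
  then show ?thesis using inj[of "b \<otimes> a" \<one>] a b by auto
qed

text \<open>The quotient module \<open>R/I\<close>, realised on a set of representatives.\<close>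

lemma quotient_right_module:
  assumes I: "right_ideal I"
  shows "\<exists>C :: ('a, 'a) module. \<exists>x. cyclic_right_module R C \<and> x \<in> carrier C \<and>
    I = right_annihilator R C x"
proof -
  note I' = right_idealD[OF I]
  define p where "p x = (SOME y. y \<in> carrier R \<and> x \<ominus> y \<in> I)" for x
  have pex: "p x \<in> carrier R \<and> x \<ominus> p x \<in> I" if "x \<in> carrier R" for x
    unfolding p_def by (rule someI[of _ x]) (use that I' in \<open>simp add: a_minus_def r_neg\<close>)
  then have pc [simp]: "p x \<in> carrier R" if "x \<in> carrier R" for x using that by blast
  have tri: "x \<ominus> z = (x \<ominus> y) \<oplus> (y \<ominus> z)"
    if "x \<in> carrier R" "y \<in> carrier R" "z \<in> carrier R" for x y z
    using that by (simp add: a_minus_def a_assoc r_neg1)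
  have swap: "y \<ominus> x \<in> I" if "x \<in> carrier R" "y \<in> carrier R" "x \<ominus> y \<in> I" for x y
    using I'(5)[OF that(3)] that(1,2) by (simp add: a_minus_def minus_add a_comm)
  have trans: "x \<ominus> z \<in> I"
    if "x \<in> carrier R" "y \<in> carrier R" "z \<in> carrier R" "x \<ominus> y \<in> I" "y \<ominus> z \<in> I" for x y z
    using tri[OF that(1,2,3)] I'(3)[OF that(4,5)] by simp
  \<comment> \<open>\<open>p\<close> is constant exactly on the cosets of \<open>I\<close>; its
    compatibility with addition and the action reduces to this.\<close>
  have cong: "p x = p y \<longleftrightarrow> x \<ominus> y \<in> I" if xy: "x \<in> carrier R" "y \<in> carrier R" for x y
  proof
    assume "p x = p y"
    then show "x \<ominus> y \<in> I"
      using trans[of x "p x" y] swap[of y "p x"] pex[OF xy(1)] pex[OF xy(2)] xy by simp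
  next
    assume "x \<ominus> y \<in> I"
    then have "(z \<in> carrier R \<and> x \<ominus> z \<in> I) \<longleftrightarrow> (z \<in> carrier R \<and> y \<ominus> z \<in> I)" for z
      using trans swap xy by blast
    then show "p x = p y" unfolding p_def by presburger
  qed
  have pp: "p (p x) = p x" if "x \<in> carrier R" for x
  proof -
    show ?thesis using cong[of "p x" x] swap[of x "p x"] pex[OF that] that by simp
  qed
  have padd: "p (p x \<oplus> y) = p (x \<oplus> y)" "p (y \<oplus> p x) = p (y \<oplus> x)"
    if "x \<in> carrier R" "y \<in> carrier R" for x y
  proof -
    have "\<ominus> (x \<oplus> y) = \<ominus> y \<oplus> \<ominus> x"
      using that by (simp add: minus_add a_comm)
    then have "(p x \<oplus> y) \<ominus> (x \<oplus> y) = p x \<ominus> x"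
      using that by (simp add: a_minus_def a_assoc r_neg2)
    moreover have "p x \<ominus> x \<in> I" using cong[of "p x" x] pp that by simp
    ultimately show *: "p (p x \<oplus> y) = p (x \<oplus> y)" using cong that by simp
    then show "p (y \<oplus> p x) = p (y \<oplus> x)" using that by (simp add: a_comm)
  qed
  have pmult: "p (p x \<otimes> r) = p (x \<otimes> r)" if "x \<in> carrier R" "r \<in> carrier R" for x r
  proof -
    have "p x \<otimes> r \<ominus> x \<otimes> r = (p x \<ominus> x) \<otimes> r"
      using that by (simp add: a_minus_def l_distr l_minus)
    moreover have "p x \<ominus> x \<in> I" using cong[of "p x" x] pp that by simp
    ultimately show ?thesis using cong that I'(4) by simp
  qed
  have plin: "p (p x \<otimes> r \<oplus> p x \<otimes> t) = p (x \<otimes> r \<oplus> x \<otimes> t)"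
    if "x \<in> carrier R" "r \<in> carrier R" "t \<in> carrier R" for x r t
    using pmult[of x "r \<oplus> t"] that by (simp add: r_distr)
  define C :: "('a, 'a) module" where
    "C = \<lparr>carrier = p ` carrier R, monoid.mult = undefined, one = undefined, ring.zero = p \<zero>,
      ring.add = (\<lambda>x y. p (x \<oplus> y)), smult = (\<lambda>r x. p (x \<otimes> r))\<rparr>"
  have "abelian_group C"
  proof (rule abelian_groupI)
    fix x assume "x \<in> carrier C"
    then obtain u where u: "u \<in> carrier R" "x = p u" by (auto simp: C_def)
    show "\<exists>y\<in>carrier C. y \<oplus>\<^bsub>C\<^esub> x = \<zero>\<^bsub>C\<^esub>"
      by (rule bexI[of _ "p (\<ominus> u)"]) (use u in \<open>auto simp: C_def padd l_neg\<close>)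
  qed (auto simp: C_def padd pp, auto simp: a_ac)
  then have mod: "right_module R C"
    by (intro right_module.intro right_module_axioms.intro ring_axioms)
      (auto simp: C_def pmult padd plin pp l_distr r_distr m_assoc)
  have "carrier C = {r \<odot>\<^bsub>C\<^esub> p \<one> | r. r \<in> carrier R}"
  proof -
    have "r \<odot>\<^bsub>C\<^esub> p \<one> = p r" if "r \<in> carrier R" for r
      using that pmult[OF one_closed that] by (simp add: C_def)
    then have "{r \<odot>\<^bsub>C\<^esub> p \<one> | r. r \<in> carrier R} = p ` carrier R" by force
    then show ?thesis by (simp add: C_def)
  qed
  then have "cyclic_right_module R C" and "p \<one> \<in> carrier C"
    using mod by (auto simp: cyclic_right_module_def C_def)
  moreover have "I = right_annihilator R C (p \<one>)"
  proof -
    have "r \<in> I \<longleftrightarrow> p r = p \<zero>" if "r \<in> carrier R" for r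
      using cong[of r \<zero>] that by (simp add: a_minus_def)
    then show ?thesis using I'(1) by (auto simp: right_annihilator_def C_def pmult)
  qed
  ultimately show ?thesis by blast
qed

end

section \<open>Annihilators in free modules and the CF condition\<close>

lemma (in right_module) smult_zero_right:
  assumes "r \<in> carrier R"
  shows "r \<odot>\<^bsub>M\<^esub> \<zero>\<^bsub>M\<^esub> = \<zero>\<^bsub>M\<^esub>"
proof -
  have c: "r \<odot>\<^bsub>M\<^esub> \<zero>\<^bsub>M\<^esub> \<in> carrier M" using assms smult_closed by simp
  have "r \<odot>\<^bsub>M\<^esub> \<zero>\<^bsub>M\<^esub> \<oplus>\<^bsub>M\<^esub> r \<odot>\<^bsub>M\<^esub> \<zero>\<^bsub>M\<^esub> = r \<odot>\<^bsub>M\<^esub> \<zero>\<^bsub>M\<^esub>"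
    using smult_vector_distr[OF assms, of "\<zero>\<^bsub>M\<^esub>" "\<zero>\<^bsub>M\<^esub>"] by simp
  then show ?thesis using M.add.r_cancel_one'[OF c c] by simp
qed

lemma (in right_module) smult_zero_left:
  assumes "x \<in> carrier M"
  shows "\<zero>\<^bsub>R\<^esub> \<odot>\<^bsub>M\<^esub> x = \<zero>\<^bsub>M\<^esub>"
proof -
  have c: "\<zero>\<^bsub>R\<^esub> \<odot>\<^bsub>M\<^esub> x \<in> carrier M" using assms smult_closed by simp
  have "\<zero>\<^bsub>R\<^esub> \<odot>\<^bsub>M\<^esub> x \<oplus>\<^bsub>M\<^esub> \<zero>\<^bsub>R\<^esub> \<odot>\<^bsub>M\<^esub> x = \<zero>\<^bsub>R\<^esub> \<odot>\<^bsub>M\<^esub> x"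
    using smult_scalar_distr[of "\<zero>\<^bsub>R\<^esub>" "\<zero>\<^bsub>R\<^esub>" x] assms by simp
  then show ?thesis using M.add.r_cancel_one'[OF c c] by simp
qed

lemma (in right_module) smult_finsum:
  assumes "finite A" "r \<in> carrier R" "\<And>b. b \<in> A \<Longrightarrow> g b \<in> carrier M"
  shows "r \<odot>\<^bsub>M\<^esub> finsum M g A = finsum M (\<lambda>b. r \<odot>\<^bsub>M\<^esub> g b) A"
  using assms(1,3)
proof (induction A rule: finite_induct)
  case empty
  then show ?case using smult_zero_right assms(2) by simp
next
  case (insert b A)
  then have "finsum M g A \<in> carrier M" by (intro M.finsum_closed) auto
  then show ?case
    using insert assms(2) by (simp add: Pi_iff smult_closed smult_vector_distr)
qed

text \<open>In a free module the annihilator of an element is the annihilator of its finitely many nonzero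
  coordinates.\<close>

lemma (in right_module) right_annihilator_free:
  assumes B: "right_module_basis R M B" and u: "u \<in> carrier M"
  shows "\<exists>F. finite F \<and> F \<subseteq> carrier R \<and> right_annihilator R M u = R.rann F"
proof -
  have Bc: "B \<subseteq> carrier M" using B by (simp add: right_module_basis_def)
  obtain f where f: "f \<in> B \<rightarrow>\<^sub>E carrier R" "finite {b \<in> B. f b \<noteq> \<zero>\<^bsub>R\<^esub>}"
    "u = finsum M (\<lambda>b. f b \<odot>\<^bsub>M\<^esub> b) {b \<in> B. f b \<noteq> \<zero>\<^bsub>R\<^esub>}"
    using B u unfolding right_module_basis_def by blast
  define S where "S = {b \<in> B. f b \<noteq> \<zero>\<^bsub>R\<^esub>}"
  have S: "finite S" "S \<subseteq> B" using f by (auto simp: S_def)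
  have fc: "f b \<in> carrier R" if "b \<in> B" for b using f that by auto
  have mult: "r \<odot>\<^bsub>M\<^esub> u = finsum M (\<lambda>b. (f b \<otimes>\<^bsub>R\<^esub> r) \<odot>\<^bsub>M\<^esub> b) S" if r: "r \<in> carrier R" for r
  proof -
    have "r \<odot>\<^bsub>M\<^esub> u = finsum M (\<lambda>b. r \<odot>\<^bsub>M\<^esub> (f b \<odot>\<^bsub>M\<^esub> b)) S"
      unfolding f(3) S_def[symmetric]
      by (rule smult_finsum[OF S(1) r]) (use S Bc fc smult_closed in \<open>auto simp: subset_iff\<close>)
    also have "\<dots> = finsum M (\<lambda>b. (f b \<otimes>\<^bsub>R\<^esub> r) \<odot>\<^bsub>M\<^esub> b) S"
      by (rule M.finsum_cong') (use S Bc fc r in \<open>auto simp: smult_assoc smult_closed subset_iff\<close>)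
    finally show ?thesis .
  qed
  have "r \<odot>\<^bsub>M\<^esub> u = \<zero>\<^bsub>M\<^esub> \<longleftrightarrow> (\<forall>x\<in>f ` S. x \<otimes>\<^bsub>R\<^esub> r = \<zero>\<^bsub>R\<^esub>)" if r: "r \<in> carrier R" for r
  proof
    assume z: "r \<odot>\<^bsub>M\<^esub> u = \<zero>\<^bsub>M\<^esub>"
    let ?P = "\<lambda>g. g \<in> B \<rightarrow>\<^sub>E carrier R \<and> finite {b \<in> B. g b \<noteq> \<zero>\<^bsub>R\<^esub>} \<and>
        \<zero>\<^bsub>M\<^esub> = finsum M (\<lambda>b. g b \<odot>\<^bsub>M\<^esub> b) {b \<in> B. g b \<noteq> \<zero>\<^bsub>R\<^esub>}"
    \<comment> \<open>Both \<open>g0\<close> and \<open>g1\<close> are coefficient families of zero,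
      the second from the coordinates of \<open>u\<close> multiplied by \<open>r\<close>; uniqueness
      identifies them. Such families are extensional, whence \<open>restrict\<close>.\<close>
    define g0 where "g0 = restrict (\<lambda>b. \<zero>\<^bsub>R\<^esub>) B"
    define g1 where "g1 = restrict (\<lambda>b. f b \<otimes>\<^bsub>R\<^esub> r) B"
    have "{b \<in> B. g0 b \<noteq> \<zero>\<^bsub>R\<^esub>} = {}" by (auto simp: g0_def)
    then have P0: "?P g0" by (simp add: g0_def)
    \<comment> \<open>The support of \<open>g1\<close> may be smaller than \<open>S\<close>; the
      missing terms vanish.\<close>
    have sub: "{b \<in> B. g1 b \<noteq> \<zero>\<^bsub>R\<^esub>} \<subseteq> S" using r by (auto simp: g1_def S_def)
    have "finsum M (\<lambda>b. g1 b \<odot>\<^bsub>M\<^esub> b) {b \<in> B. g1 b \<noteq> \<zero>\<^bsub>R\<^esub>} =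
        finsum M (\<lambda>b. (f b \<otimes>\<^bsub>R\<^esub> r) \<odot>\<^bsub>M\<^esub> b) S"
    proof (rule M.add.finprod_mono_neutral_cong_left[OF S(1) sub])
      fix b assume "b \<in> S - {b \<in> B. g1 b \<noteq> \<zero>\<^bsub>R\<^esub>}"
      then have "f b \<otimes>\<^bsub>R\<^esub> r = \<zero>\<^bsub>R\<^esub>" "b \<in> carrier M" using S Bc by (auto simp: g1_def)
      then show "(f b \<otimes>\<^bsub>R\<^esub> r) \<odot>\<^bsub>M\<^esub> b = \<zero>\<^bsub>M\<^esub>" using smult_zero_left by simp
    qed (use S Bc fc r in \<open>auto simp: g1_def smult_closed subset_iff\<close>)
    then have "\<zero>\<^bsub>M\<^esub> = finsum M (\<lambda>b. g1 b \<odot>\<^bsub>M\<^esub> b) {b \<in> B. g1 b \<noteq> \<zero>\<^bsub>R\<^esub>}"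
      using mult[OF r] z by simp
    then have P1: "?P g1"
      using finite_subset[OF sub S(1)] fc r by (auto simp: g1_def)
    have "\<exists>!g. ?P g" using B M.zero_closed unfolding right_module_basis_def by blast
    then have "g0 = g1" using P0 P1 by blast
    then have "g0 b = g1 b" for b by simp
    then have "f b \<otimes>\<^bsub>R\<^esub> r = \<zero>\<^bsub>R\<^esub>" if "b \<in> S" for b
      using that S unfolding g0_def g1_def by (metis restrict_apply' subsetD)
    then show "\<forall>x\<in>f ` S. x \<otimes>\<^bsub>R\<^esub> r = \<zero>\<^bsub>R\<^esub>" by blast
  next
    assume z: "\<forall>x\<in>f ` S. x \<otimes>\<^bsub>R\<^esub> r = \<zero>\<^bsub>R\<^esub>"
    have "finsum M (\<lambda>b. (f b \<otimes>\<^bsub>R\<^esub> r) \<odot>\<^bsub>M\<^esub> b) S = finsum M (\<lambda>b. \<zero>\<^bsub>M\<^esub>) S"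
      by (rule M.finsum_cong') (use z S Bc smult_zero_left in auto)
    then show "r \<odot>\<^bsub>M\<^esub> u = \<zero>\<^bsub>M\<^esub>" using mult[OF r] by simp
  qed
  then have "right_annihilator R M u = R.rann (f ` S)"
    by (auto simp: right_annihilator_def R.rann_def)
  then show ?thesis using S fc by blast
qed

text \<open>\<open>I\<close> annihilates the generator of R/I. An embedding into a free module
  preserves this annihilator, which is then that of the coordinates.\<close>

lemma (in ring) CF_right_annihilator:
  assumes CF: "right_CF_ring R TYPE('f)" and I: "right_ideal I"
  shows "\<exists>F. finite F \<and> F \<subseteq> carrier R \<and> I = rann F"
proof -
  obtain C :: "('a, 'a) module" and x where C: "cyclic_right_module R C" "x \<in> carrier C"
    "I = right_annihilator R C x"
    using quotient_right_module[OF I] by blast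
  obtain F :: "('a, 'f) module" where F: "free_right_module R F" "right_module_embeds R C F"
    using right_CF_ring_embeds[OF CF C(1)] by blast
  interpret C: right_module R C using C(1) by (simp add: cyclic_right_module_def)
  interpret F: right_module R F using F(1) by (simp add: free_right_module_def)
  obtain h where h: "h \<in> right_module_hom R C F" "inj_on h (carrier C)"
    using F(2) by (auto simp: right_module_embeds_def)
  have hc: "h y \<in> carrier F" if "y \<in> carrier C" for y
    using h that by (auto simp: right_module_hom_def)
  have smult: "h (r \<odot>\<^bsub>C\<^esub> y) = r \<odot>\<^bsub>F\<^esub> h y" if "r \<in> carrier R" "y \<in> carrier C" for r y
    using h that by (auto simp: right_module_hom_def)
  have "\<zero> \<odot>\<^bsub>C\<^esub> x = \<zero>\<^bsub>C\<^esub>" using C.smult_zero_left C(2) by blast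
  then have h0: "h \<zero>\<^bsub>C\<^esub> = \<zero>\<^bsub>F\<^esub>"
    using smult[OF zero_closed C(2)] F.smult_zero_left[OF hc[OF C(2)]] by simp
  have "r \<odot>\<^bsub>C\<^esub> x = \<zero>\<^bsub>C\<^esub> \<longleftrightarrow> r \<odot>\<^bsub>F\<^esub> h x = \<zero>\<^bsub>F\<^esub>" if r: "r \<in> carrier R" for r
    using inj_on_eq_iff[OF h(2) C.smult_closed[OF r C(2)] C.M.zero_closed] smult[OF r C(2)] h0
    by simp
  then have "I = right_annihilator R F (h x)"
    unfolding C(3) by (auto simp: right_annihilator_def)
  then show ?thesis
    using F(1) F.right_annihilator_free hc[OF C(2)] by (auto simp: free_right_module_def)
qed

text \<open>\<open>cs\<close> concerns right ideals that are both semisimple and singular, so it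
  follows from weak CS as well as from s-CS.\<close>

lemma (in ring) right_artinian_if_singular_semisimple_closure:
  assumes GC2: "right_GC2_ring R" and CF: "right_CF_ring R TYPE('f)"
    and cs: "\<And>N. \<lbrakk>semisimple_submodule R (regular_right_module R) N;
        singular_submodule R (regular_right_module R) N\<rbrakk> \<Longrightarrow>
      \<exists>D. direct_summand R (regular_right_module R) D \<and>
        essential_in R (regular_right_module R) N D"
  shows "right_artinian_ring R"
proof -
  have closure: "\<exists>e\<in>carrier R. e \<otimes> e = e \<and> (\<forall>n\<in>right_span A. e \<otimes> n = n) \<and>
      ess_in (right_span A) {e \<otimes> r | r. r \<in> carrier R}"
    if A: "\<And>x. x \<in> A \<Longrightarrow> simple_gen x \<and> x \<in> right_singular" for A
  proof -
    have Ac: "A \<subseteq> carrier R" using A simple_genD(1) by blast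
    have "right_span A \<subseteq> right_singular"
      using right_span_least[OF right_ideal_right_singular] A by blast
    then obtain D where D: "direct_summand R (regular_right_module R) D"
      "essential_in R (regular_right_module R) (right_span A) D"
      using cs[OF semisimple_submodule_right_span singular_submodule_regularI] A
        right_ideal_right_span[OF Ac] by blast
    then have Di: "right_ideal D" "right_span A \<subseteq> D" "ess_in (right_span A) D"
      by (auto simp: essential_in_regular_iff)
    \<comment> \<open>The left identity \<open>e\<close> lies in \<open>D\<close>, so it is
      idempotent, and \<open>eR\<close>, contained in \<open>D\<close>, inherits essentiality of the
      span.\<close>
    obtain e where e: "e \<in> D" "\<forall>x\<in>D. e \<otimes> x = x"
      using direct_summand_idempotent[OF D(1)] by blast
    have "e \<in> carrier R" "{e \<otimes> r | r. r \<in> carrier R} \<subseteq> D"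
      using right_idealD(1,4)[OF Di(1)] e(1) by blast+
    then show ?thesis
      using e Di by (intro bexI[of _ e]) (auto simp: ess_in_def subset_iff)
  qed
  interpret cf_gc2_ring R
    by (intro cf_gc2_ring.intro cf_gc2_ring_axioms.intro ring_axioms
        GC2_left_inverse[OF GC2] CF_right_annihilator[OF CF] closure)
  show ?thesis
    unfolding right_artinian_ring_def artinian_module_def submodule_regular_iff
    using right_ideal_dcc by blast
qed

theorem theorem1:
  fixes R :: "('a, 'm) ring_scheme"
  assumes "ring R"
    and "right_GC2_ring R"
    and "right_CF_ring R TYPE('f)"
  shows "(right_weak_CS_ring R \<longrightarrow> right_artinian_ring R) \<and>
         (right_s_CS_ring R \<longrightarrow> right_artinian_ring R)"
proof -
  note artinian = ring.right_artinian_if_singular_semisimple_closure[OF assms]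
  show ?thesis
    using artinian unfolding right_weak_CS_ring_def weak_CS_module_def right_s_CS_ring_def s_CS_module_def
    by blast
qed

end
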